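(* Let $n\geq 3$ be an integer and let $p$ be a prime with $p\equiv 1\pmod{n}$. Then $$ p^n\cdot {}_{n+1}F_{n}\bigg[\begin{matrix} 1&1&\ldots&1\\ &\frac{n+1}{n}&\ldots&\frac{n+1}{n}\end{matrix}\bigg | \, 1\bigg]_{p-1}=\sum_{k=0}^{p-1}\left(\frac{p\cdot k!}{\left(\frac{n+1}{n}\right)_k}\right)^n \equiv-\Gamma_p\left(\frac{1}{n}\right)^n\pmod{p^3}. $$
   Context: For $x$ a real or $p$-adic number, $(x)_k=x(x+1)\cdots(x+k-1)$ for $k\geq1$ and $(x)_0=1$. The truncated hypergeometric series is $$ {}_{n+1}F_{n}\bigg[\begin{matrix}x_1&\ldots&x_{n+1}\\ &y_1&\ldots&y_{n}\end{matrix}\bigg|\,z\bigg]_{m}:=\sum_{k=0}^m\frac{(x_1)_k\cdots(x_{n+1})_k}{(y_1)_k\cdots (y_{n})_k}\cdot\frac{z^k}{k!}. $$ $\Gamma_p$ is Morita's $p$-adic Gamma function: for integers $N\geq1$, $\Gamma_p(N)=(-1)^N\prod_{1\leq k<N,\ p\nmid k}k$, $\Gamma_p(0)=1$, extended to $x\in\mathbb Z_p$ by $\Gamma_p(x)=\lim_{N\to x\ p\text{-adically}}\Gamma_p(N)$. Congruences are in $\mathbb Z_p$ (with $1/n\in\mathbb Z_p$). *)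

theory Defs
  imports "HOL-Algebra.Algebra" "HOL-Number_Theory.Number_Theory"
begin

definition trunc_hypergeometric ::
    "'a::field_char_0 list \<Rightarrow> 'a list \<Rightarrow> 'a \<Rightarrow> nat \<Rightarrow> 'a" where
  "trunc_hypergeometric xs ys z m =
     (\<Sum>k=0..m. (\<Prod>x\<leftarrow>xs. pochhammer x k) / (\<Prod>y\<leftarrow>ys. pochhammer y k) * (z ^ k / fact k))"

text \<open>
  The ring of \<open>p\<close>-adic integers is the inverse limit of the rings of integers modulo \<open>p ^ k\<close>.
  An element \<open>f\<close> is the sequence of its residues: \<open>f k\<close> is the representative of \<open>f\<close> modulo
  \<open>p ^ k\<close> in \<open>{0..<p ^ k}\<close> (the range condition is implied by the coherence condition).
\<close>

definition padic_ring :: "nat \<Rightarrow> (nat \<Rightarrow> int) ring" where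
  "padic_ring p =
    \<lparr>carrier = {f. \<forall>k. f (Suc k) mod int p ^ k = f k},
     monoid.mult = (\<lambda>f g k. (f k * g k) mod int p ^ k),
     monoid.one = (\<lambda>k. 1 mod int p ^ k),
     ring.zero = (\<lambda>k. 0),
     ring.add = (\<lambda>f g k. (f k + g k) mod int p ^ k)\<rparr>"

definition padic_of_int :: "nat \<Rightarrow> int \<Rightarrow> nat \<Rightarrow> int" where
  "padic_of_int p a = (\<lambda>k. a mod int p ^ k)"

definition p_integral :: "nat \<Rightarrow> rat \<Rightarrow> bool" where
  "p_integral p q \<longleftrightarrow> \<not> int p dvd snd (quotient_of q)"

text \<open>The embedding of the \<open>p\<close>-integral rationals; it is meaningful only under \<open>p_integral p q\<close>.\<close>

definition padic_of_rat :: "nat \<Rightarrow> rat \<Rightarrow> nat \<Rightarrow> int" where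
  "padic_of_rat p q =
     padic_of_int p (fst (quotient_of q)) \<otimes>\<^bsub>padic_ring p\<^esub>
     inv\<^bsub>padic_ring p\<^esub> padic_of_int p (snd (quotient_of q))"

definition padic_cong :: "nat \<Rightarrow> nat \<Rightarrow> (nat \<Rightarrow> int) \<Rightarrow> (nat \<Rightarrow> int) \<Rightarrow> bool" where
  "padic_cong p m x y \<longleftrightarrow>
     padic_of_int p (int p ^ m) divides\<^bsub>padic_ring p\<^esub> (x \<ominus>\<^bsub>padic_ring p\<^esub> y)"

text \<open>For \<open>N = 0\<close> the product is empty, so the value is \<open>1\<close>.\<close>

definition Gamma_p_nat :: "nat \<Rightarrow> nat \<Rightarrow> int" where
  "Gamma_p_nat p N = (- 1) ^ N * (\<Prod>k | 1 \<le> k \<and> k < N \<and> \<not> p dvd k. int k)"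

text \<open>
  \<open>y\<close> is the \<open>p\<close>-adic limit of \<open>g N\<close> as the natural number \<open>N\<close> tends to \<open>x\<close> \<open>p\<close>-adically.
  Closeness up to \<open>p ^ m\<close> means equality of the residues modulo \<open>p ^ m\<close>.
\<close>

definition is_padic_limit :: "nat \<Rightarrow> (nat \<Rightarrow> int) \<Rightarrow> (nat \<Rightarrow> int) \<Rightarrow> (nat \<Rightarrow> int) \<Rightarrow> bool" where
  "is_padic_limit p g x y \<longleftrightarrow>
     (\<forall>m. \<exists>M. \<forall>N. padic_of_int p (int N) M = x M \<longrightarrow> padic_of_int p (g N) m = y m)"

definition Gamma_p :: "nat \<Rightarrow> (nat \<Rightarrow> int) \<Rightarrow> nat \<Rightarrow> int" where
  "Gamma_p p x =
     (THE y. y \<in> carrier (padic_ring p) \<and> is_padic_limit p (Gamma_p_nat p) x y)"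

lemma padic_coherent:
  assumes "f \<in> carrier (padic_ring p)" "p > 0" "i \<le> j"
  shows "f j mod int p ^ i = f i"
  using assms(3)
proof (induction j rule: dec_induct)
  case base
  have "f (Suc i) mod int p ^ i = f i" using assms(1) by (simp add: padic_ring_def)
  thus ?case by (metis mod_mod_trivial)
next
  case (step j)
  have "f (Suc j) mod int p ^ j = f j" using assms(1) by (simp add: padic_ring_def)
  hence "f (Suc j) mod int p ^ i = f j mod int p ^ i"
    using step.hyps by (metis le_imp_power_dvd mod_mod_cancel)
  thus ?case using step.IH by simp
qed

lemma padic_of_int_closed: "padic_of_int p a \<in> carrier (padic_ring p)"
  by (simp add: padic_ring_def padic_of_int_def mod_mod_cancel)

lemma padic_ring_cring:
  assumes "p > 0"
  shows "cring (padic_ring p)"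
proof -
  have red: "f k mod int p ^ k = f k" if "f \<in> carrier (padic_ring p)" for f k
    using padic_coherent[OF that assms, of k k] by simp
  have coh: "f (Suc k) mod int p ^ k = f k" if "f \<in> carrier (padic_ring p)" for f k
    using that by (simp add: padic_ring_def)
  have dv: "int p ^ k dvd int p ^ Suc k" for k by simp
  have mulc: "(\<lambda>k. (f k * g k) mod int p ^ k) \<in> carrier (padic_ring p)"
    if "f \<in> carrier (padic_ring p)" "g \<in> carrier (padic_ring p)" for f g
  proof -
    have "(f (Suc k) * g (Suc k)) mod int p ^ Suc k mod int p ^ k = (f k * g k) mod int p ^ k" for k
      using coh[OF that(1), of k] coh[OF that(2), of k] mod_mod_cancel[OF dv]
      by (metis mod_mult_eq)
    thus ?thesis by (simp add: padic_ring_def)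
  qed
  have addc: "(\<lambda>k. (f k + g k) mod int p ^ k) \<in> carrier (padic_ring p)"
    if "f \<in> carrier (padic_ring p)" "g \<in> carrier (padic_ring p)" for f g
  proof -
    have "(f (Suc k) + g (Suc k)) mod int p ^ Suc k mod int p ^ k = (f k + g k) mod int p ^ k" for k
      using coh[OF that(1), of k] coh[OF that(2), of k] mod_mod_cancel[OF dv]
      by (metis mod_add_eq)
    thus ?thesis by (simp add: padic_ring_def)
  qed
  have negc: "(\<lambda>k. (- f k) mod int p ^ k) \<in> carrier (padic_ring p)"
    if "f \<in> carrier (padic_ring p)" for f
  proof -
    have "(- f (Suc k)) mod int p ^ Suc k mod int p ^ k = (- f k) mod int p ^ k" for k
      using coh[OF that(1), of k] mod_mod_cancel[OF dv] by (metis mod_minus_eq)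
    thus ?thesis by (simp add: padic_ring_def)
  qed
  let ?R = "padic_ring p"
  have m: "x \<otimes>\<^bsub>?R\<^esub> y = (\<lambda>k. (x k * y k) mod int p ^ k)" for x y by (simp add: padic_ring_def)
  have a: "x \<oplus>\<^bsub>?R\<^esub> y = (\<lambda>k. (x k + y k) mod int p ^ k)" for x y by (simp add: padic_ring_def)
  have z: "\<zero>\<^bsub>?R\<^esub> = (\<lambda>k. 0)" by (simp add: padic_ring_def)
  have o: "\<one>\<^bsub>?R\<^esub> = (\<lambda>k. 1 mod int p ^ k)" by (simp add: padic_ring_def)
  have zc: "(\<lambda>k. 0) \<in> carrier ?R" by (simp add: padic_ring_def)
  have oc: "(\<lambda>k. 1 mod int p ^ k) \<in> carrier ?R"
    using padic_of_int_closed[of p 1] by (simp add: padic_of_int_def)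
  have ab: "abelian_group ?R"
  proof (rule abelian_groupI)
    fix x assume x: "x \<in> carrier ?R"
    show "\<exists>y\<in>carrier ?R. y \<oplus>\<^bsub>?R\<^esub> x = \<zero>\<^bsub>?R\<^esub>"
      by (rule bexI[OF _ negc[OF x]]) (simp add: a z mod_add_left_eq)
  next
    show "x \<oplus>\<^bsub>?R\<^esub> y \<oplus>\<^bsub>?R\<^esub> u = x \<oplus>\<^bsub>?R\<^esub> (y \<oplus>\<^bsub>?R\<^esub> u)" for x y u
      by (simp add: a mod_add_left_eq mod_add_right_eq add.assoc)
  qed (simp_all add: a z addc zc red add.commute)
  have one_r: "(\<lambda>k. x k * (1 mod int p ^ k) mod int p ^ k) = x"
    if "x \<in> carrier ?R" for x
    using red[OF that] mod_mult_right_eq[of "x _" 1] by (simp add: fun_eq_iff)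
  have mon: "comm_monoid ?R"
  proof (rule comm_monoidI)
    show "x \<otimes>\<^bsub>?R\<^esub> y \<otimes>\<^bsub>?R\<^esub> u = x \<otimes>\<^bsub>?R\<^esub> (y \<otimes>\<^bsub>?R\<^esub> u)" for x y u
      by (simp add: m mod_mult_left_eq mod_mult_right_eq mult.assoc)
  qed (simp_all add: m o mulc oc one_r mult.commute)
  show ?thesis
  proof (rule cringI[OF ab mon])
    show "(x \<oplus>\<^bsub>?R\<^esub> y) \<otimes>\<^bsub>?R\<^esub> u = x \<otimes>\<^bsub>?R\<^esub> u \<oplus>\<^bsub>?R\<^esub> y \<otimes>\<^bsub>?R\<^esub> u" for x y u
      by (simp add: m a mod_mult_left_eq mod_add_eq distrib_right)
  qed
qed

lemma is_padic_limit_unique: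
  assumes "x \<in> carrier (padic_ring p)" "p > 0"
    and "is_padic_limit p g x y" "is_padic_limit p g x y'"
  shows "y = y'"
proof
  fix m
  obtain M where M: "\<And>N. padic_of_int p (int N) M = x M \<Longrightarrow> padic_of_int p (g N) m = y m"
    using assms(3) unfolding is_padic_limit_def by blast
  obtain M' where M': "\<And>N. padic_of_int p (int N) M' = x M' \<Longrightarrow> padic_of_int p (g N) m = y' m"
    using assms(4) unfolding is_padic_limit_def by blast
  define L where "L = max M M'"
  have "x L mod int p ^ L = x L" using padic_coherent[OF assms(1,2), of L L] by simp
  hence "x L \<ge> 0" using assms(2)
    by (metis pos_mod_sign of_nat_0_less_iff zero_less_power)
  hence N: "int (nat (x L)) = x L" by simp
  have "padic_of_int p (int (nat (x L))) j = x j" if "j \<le> L" for j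
    unfolding N using padic_coherent[OF assms(1,2) that] by (simp add: padic_of_int_def)
  thus "y m = y' m" using M M' unfolding L_def by (metis max.cobounded1 max.cobounded2)
qed

end

theory Submission imports Defs begin

text \<open>
  Write \<open>a = 1 / n\<close>, \<open>m = (p - 1) / n\<close>, \<open>u\<^sub>k = p k! / (1 + a)\<^sub>k\<close> and
  \<open>v\<^sub>k = p (1 + p / n)\<^sub>k / (1 + a)\<^sub>k\<close>. Since \<open>1 + p / n = (1 + a) + m\<close>, one has
  \<open>v\<^sub>k = (k + 1 + a)\<^sub>m / (a)\<^sub>m\<close>, a polynomial in \<open>k\<close> of degree \<open>m\<close>. The \<open>(p - 1)\<close>-st finite
  difference of its \<open>n\<close>-th power therefore gives the exact identity
  \<open>\<Sum>\<^sub>k (-1)\<^sup>k (p - 1 choose k) v\<^sub>k\<^sup>n = (p - 1)! / (a)\<^sub>m\<^sup>n\<close>. The right-hand side is congruent to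
  \<open>- \<Gamma>\<^sub>p(a)\<^sup>n\<close> modulo \<open>p\<^sup>3\<close>, by the functional equation and because a shift by a multiple of \<open>p\<close>
  does not change \<open>(p - 1)!\<close> modulo \<open>p\<^sup>3\<close>.
  On the left, the ratio of the \<open>k\<close>-th summand and \<open>u\<^sub>k\<^sup>n\<close> is the product over \<open>1 \<le> l \<le> k\<close> of
  \<open>(1 - p / l) (1 + p / (n l))\<^sup>n\<close>, in which the terms linear in \<open>p\<close> cancel. So the two sums differ by a
  multiple of \<open>p\<^sup>2 \<Sum>\<^sub>k u\<^sub>k\<^sup>n H\<^sub>k\<close> with \<open>H\<^sub>k = 1 + 1 / 2\<^sup>2 + \<dots> + 1 / k\<^sup>2\<close>, and this sum vanishes modulo \<open>p\<close>.
\<close>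

section \<open>Congruences between p-integral rational numbers\<close>

text \<open>Reducing a fraction replaces its denominator by a divisor, so any representation with
  denominator prime to \<open>p\<close> certifies integrality. The closure properties below work
  with such unreduced fractions.\<close>

lemma p_integral_iff:
  assumes "Factorial_Ring.prime p"
  shows "p_integral p q \<longleftrightarrow> (\<exists>a b. \<not> int p dvd b \<and> q = of_int a / of_int b)"
proof
  assume "p_integral p q"
  moreover have "q = of_int (fst (quotient_of q)) / of_int (snd (quotient_of q))"
    by (rule quotient_of_div) simp
  ultimately show "\<exists>a b. \<not> int p dvd b \<and> q = of_int a / of_int b"
    unfolding p_integral_def by blast
next
  assume "\<exists>a b. \<not> int p dvd b \<and> q = of_int a / of_int b"
  then obtain a b where ab: "\<not> int p dvd b" "q = of_int a / of_int b" by blast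
  obtain c d where cd: "quotient_of q = (c, d)" by fastforce
  have "d > 0" "coprime c d" "q = of_int c / of_int d"
    using quotient_of_denom_pos[OF cd] quotient_of_coprime[OF cd] quotient_of_div[OF cd] by auto
  moreover have "b \<noteq> 0" using ab(1) by auto
  ultimately have "(of_int (a * d) :: rat) = of_int (c * b)"
    using ab(2) by (simp add: field_simps)
  hence "a * d = c * b" by linarith
  hence "d dvd b" using \<open>coprime c d\<close>
    by (metis coprime_commute coprime_dvd_mult_right_iff dvd_triv_right)
  thus "p_integral p q" unfolding p_integral_def cd using ab(1) dvd_trans by auto
qed

text \<open>Congruence modulo \<open>p ^ r\<close> over the localization of the integers at
  \<open>p\<close>. Only the difference is tested, so the relation makes sense before integrality of
  either side is known.\<close>

definition rat_cong :: "nat \<Rightarrow> nat \<Rightarrow> rat \<Rightarrow> rat \<Rightarrow> bool" where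
  "rat_cong p r x y \<longleftrightarrow> (\<exists>q. p_integral p q \<and> x - y = of_nat p ^ r * q)"

context
  fixes p :: nat
  assumes prime: "Factorial_Ring.prime p"
begin

lemma not_dvd_mult_int: "\<not> int p dvd a \<Longrightarrow> \<not> int p dvd b \<Longrightarrow> \<not> int p dvd a * b"
  using prime prime_dvd_mult_iff[of "int p" a b] by auto

lemma p_integral_of_int: "p_integral p (of_int a)"
  using prime_gt_1_nat[OF prime] by (simp add: p_integral_def)

lemma p_integral_of_nat: "p_integral p (of_nat a)"
  using p_integral_of_int[of "int a"] by simp

lemma p_integral_numeral [simp]: "p_integral p 0" "p_integral p 1" "p_integral p (numeral v)"
  using p_integral_of_int[of 0] p_integral_of_int[of 1] p_integral_of_int[of "numeral v"] by simp_all

lemma p_integral_inverse_int: "\<not> int p dvd b \<Longrightarrow> p_integral p (1 / of_int b)"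
  using p_integral_iff[OF prime] by (metis of_int_1)

lemma p_integral_inverse_nat: "\<not> p dvd b \<Longrightarrow> p_integral p (1 / of_nat b)"
  using p_integral_inverse_int[of "int b"] by (simp add: int_dvd_int_iff)

lemma p_integral_mult:
  assumes "p_integral p x" "p_integral p y"
  shows "p_integral p (x * y)"
proof -
  obtain a b c d where "\<not> int p dvd b" "x = of_int a / of_int b"
    "\<not> int p dvd d" "y = of_int c / of_int d"
    using assms unfolding p_integral_iff[OF prime] by blast
  hence "\<not> int p dvd b * d" "x * y = of_int (a * c) / of_int (b * d)"
    using not_dvd_mult_int by auto
  thus ?thesis unfolding p_integral_iff[OF prime] by blast
qed

lemma p_integral_add:
  assumes "p_integral p x" "p_integral p y"
  shows "p_integral p (x + y)"
proof -
  obtain a b c d where *: "\<not> int p dvd b" "x = of_int a / of_int b"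
    "\<not> int p dvd d" "y = of_int c / of_int d"
    using assms unfolding p_integral_iff[OF prime] by blast
  moreover have "b \<noteq> 0" "d \<noteq> 0" using * by auto
  ultimately have "\<not> int p dvd b * d" "x + y = of_int (a * d + c * b) / of_int (b * d)"
    using not_dvd_mult_int by (auto simp: add_frac_eq)
  thus ?thesis unfolding p_integral_iff[OF prime] by blast
qed

lemma p_integral_uminus: "p_integral p x \<Longrightarrow> p_integral p (- x)"
  using p_integral_mult[of "of_int (-1)" x] p_integral_of_int[of "-1"] by simp

lemma p_integral_diff: "p_integral p x \<Longrightarrow> p_integral p y \<Longrightarrow> p_integral p (x - y)"
  using p_integral_add[of x "- y"] p_integral_uminus by simp

lemma p_integral_power: "p_integral p x \<Longrightarrow> p_integral p (x ^ k)"
  by (induction k) (auto intro: p_integral_mult)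

lemma p_integral_sum: "(\<And>i. i \<in> A \<Longrightarrow> p_integral p (f i)) \<Longrightarrow> p_integral p (sum f A)"
  by (induction A rule: infinite_finite_induct) (auto intro: p_integral_add)

lemma p_integral_prod: "(\<And>i. i \<in> A \<Longrightarrow> p_integral p (f i)) \<Longrightarrow> p_integral p (prod f A)"
  by (induction A rule: infinite_finite_induct) (auto intro: p_integral_mult)

lemmas p_integral_intros = p_integral_of_int p_integral_of_nat p_integral_mult p_integral_add
  p_integral_uminus p_integral_diff p_integral_power p_integral_sum p_integral_prod

lemma rat_congI: "p_integral p q \<Longrightarrow> x - y = of_nat p ^ r * q \<Longrightarrow> rat_cong p r x y"
  unfolding rat_cong_def by blast

lemma rat_cong_refl [simp]: "rat_cong p r x x"
  by (rule rat_congI[of 0]) auto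

lemma rat_cong_sym:
  assumes "rat_cong p r x y"
  shows "rat_cong p r y x"
proof -
  obtain q where "p_integral p q" "x - y = of_nat p ^ r * q" using assms rat_cong_def by blast
  thus ?thesis by (intro rat_congI[of "- q"] p_integral_uminus) (auto simp: algebra_simps)
qed

lemma rat_cong_add:
  assumes "rat_cong p r x y" "rat_cong p r x' y'"
  shows "rat_cong p r (x + x') (y + y')"
proof -
  obtain q q' where "p_integral p q" "x - y = of_nat p ^ r * q"
    "p_integral p q'" "x' - y' = of_nat p ^ r * q'" using assms rat_cong_def by blast
  thus ?thesis by (intro rat_congI[of "q + q'"] p_integral_add) (auto simp: algebra_simps)
qed

lemma rat_cong_trans:
  assumes "rat_cong p r x y" "rat_cong p r y z"
  shows "rat_cong p r x z"
proof -
  obtain q q' where "p_integral p q" "x - y = of_nat p ^ r * q"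
    "p_integral p q'" "y - z = of_nat p ^ r * q'" using assms rat_cong_def by blast
  thus ?thesis by (intro rat_congI[of "q + q'"] p_integral_add) (auto simp: algebra_simps)
qed

text \<open>A factor \<open>p ^ s\<close> raises the modulus: with \<open>r = 1\<close> and
  \<open>s = 2\<close>, a correction multiplied by \<open>p ^ 2\<close> has to be known only modulo
  \<open>p\<close>.\<close>

lemma rat_cong_scale:
  assumes "rat_cong p r x y" "p_integral p c"
  shows "rat_cong p (r + s) (of_nat p ^ s * c * x) (of_nat p ^ s * c * y)"
proof -
  obtain q where q: "p_integral p q" "x - y = of_nat p ^ r * q" using assms rat_cong_def by blast
  have "of_nat p ^ s * c * x - of_nat p ^ s * c * y = of_nat p ^ s * c * (x - y)"
    by (simp add: algebra_simps)
  also have "\<dots> = of_nat p ^ (r + s) * (c * q)" unfolding q(2) by (simp add: power_add)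
  finally show ?thesis using q(1) assms(2) by (intro rat_congI[of "c * q"] p_integral_mult)
qed

lemma rat_cong_scale0:
  "rat_cong p r x y \<Longrightarrow> p_integral p c \<Longrightarrow> rat_cong p r (c * x) (c * y)"
  using rat_cong_scale[of r x y c 0] by simp

text \<open>The splitting \<open>x * x' - y * y' = x * (x' - y') + (x - y) * y'\<close> accounts for
  the two integrality hypotheses.\<close>

lemma rat_cong_mult:
  assumes "rat_cong p r x y" "rat_cong p r x' y'" "p_integral p x" "p_integral p y'"
  shows "rat_cong p r (x * x') (y * y')"
proof (rule rat_cong_trans)
  show "rat_cong p r (x * x') (x * y')" by (rule rat_cong_scale0[OF assms(2,3)])
  show "rat_cong p r (x * y') (y * y')"
    using rat_cong_scale0[OF assms(1,4)] by (simp add: mult.commute)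
qed

text \<open>Integrality of the hypergeometric sum itself will come from its congruence to an
  integer.\<close>

lemma rat_cong_integral:
  assumes "rat_cong p r x y" "p_integral p y"
  shows "p_integral p x"
proof -
  obtain q where "p_integral p q" "x - y = of_nat p ^ r * q" using assms rat_cong_def by blast
  hence "x = y + of_nat p ^ r * q" by (simp add: algebra_simps)
  thus ?thesis using \<open>p_integral p q\<close> assms(2) by (auto intro: p_integral_intros)
qed

lemma rat_cong_power:
  assumes "rat_cong p r x y" "p_integral p y"
  shows "rat_cong p r (x ^ k) (y ^ k)"
  using rat_cong_integral[OF assms]
  by (induction k) (auto intro!: rat_cong_mult p_integral_power assms)

lemma rat_cong_sum:
  "(\<And>i. i \<in> A \<Longrightarrow> rat_cong p r (f i) (g i)) \<Longrightarrow> rat_cong p r (sum f A) (sum g A)"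
  by (induction A rule: infinite_finite_induct) (auto intro: rat_cong_add)

lemma rat_cong_prod:
  assumes "\<And>i. i \<in> A \<Longrightarrow> rat_cong p r (f i) (g i)" "\<And>i. i \<in> A \<Longrightarrow> p_integral p (g i)"
  shows "rat_cong p r (prod f A) (prod g A)"
proof -
  have "p_integral p (f i)" if "i \<in> A" for i using rat_cong_integral assms that by blast
  thus ?thesis using assms
    by (induction A rule: infinite_finite_induct) (auto intro!: rat_cong_mult p_integral_prod)
qed

lemma rat_cong_of_int:
  assumes "[a = b] (mod int p ^ r)"
  shows "rat_cong p r (of_int a) (of_int b)"
proof -
  obtain c where "a - b = int p ^ r * c" using assms unfolding cong_iff_dvd_diff by blast
  hence "(of_int a - of_int b :: rat) = of_nat p ^ r * of_int c"
    by (metis of_int_diff of_int_mult of_int_of_nat_eq of_int_power)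
  thus ?thesis by (intro rat_congI[of "of_int c"] p_integral_of_int)
qed

end

section \<open>Power sums modulo a prime\<close>

text \<open>This is the \<open>N\<close>-th finite difference of a monic polynomial of degree at
  most \<open>N\<close>, given by its linear factors. When one factor is split into \<open>k\<close>
  and a constant, the constant part vanishes by degree, and
  \<open>k (N choose k) = N (N - 1 choose k - 1)\<close> lowers \<open>N\<close> and shifts every
  \<open>f i\<close> by \<open>1\<close>.\<close>

lemma alternating_binomial_prod:
  fixes f :: "'i \<Rightarrow> 'a::comm_ring_1"
  assumes "finite A" "card A \<le> N"
  shows "(\<Sum>k\<le>N. (- 1) ^ k * of_nat (N choose k) * (\<Prod>i\<in>A. of_nat k + f i)) =
         (if card A = N then (- 1) ^ N * of_nat (fact N) else 0)"
  using assms
proof (induction A arbitrary: f N rule: finite_induct)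
  case empty
  show ?case
    by (cases "N = 0") (simp_all add: choose_alternating_sum)
next
  case (insert a A)
  from insert.prems insert.hyps obtain M where N: "N = Suc M" "card A \<le> M"
    by (cases N) auto
  define Q where "Q k = (\<Prod>i\<in>A. of_nat k + f i)" for k
  have "(- 1) ^ Suc j * of_nat (Suc M choose Suc j) * of_nat (Suc j) * Q (Suc j) =
        - of_nat (Suc M) * ((- 1) ^ j * of_nat (M choose j) * (\<Prod>i\<in>A. of_nat j + (f i + 1)))" for j
  proof -
    have "(of_nat (Suc M choose Suc j) * of_nat (Suc j) :: 'a) = of_nat (Suc M) * of_nat (M choose j)"
      using Suc_times_binomial[of j M] by (metis mult.commute of_nat_mult)
    hence "(- 1) ^ Suc j * of_nat (Suc M choose Suc j) * of_nat (Suc j) * Q (Suc j) =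
      (- 1) ^ Suc j * (of_nat (Suc M) * of_nat (M choose j)) * Q (Suc j)" by (simp only: mult.assoc)
    thus ?thesis by (simp add: Q_def algebra_simps)
  qed
  hence shift: "(\<Sum>k\<le>Suc M. (- 1) ^ k * of_nat (Suc M choose k) * of_nat k * Q k) =
    - of_nat (Suc M) * (\<Sum>j\<le>M. (- 1) ^ j * of_nat (M choose j) * (\<Prod>i\<in>A. of_nat j + (f i + 1)))"
    by (subst sum.atMost_Suc_shift) (simp add: sum_distrib_left del: sum.atMost_Suc of_nat_Suc)
  have "(\<Sum>k\<le>N. (- 1) ^ k * of_nat (N choose k) * (\<Prod>i\<in>insert a A. of_nat k + f i)) =
    (\<Sum>k\<le>N. (- 1) ^ k * of_nat (N choose k) * of_nat k * Q k) +
    f a * (\<Sum>k\<le>N. (- 1) ^ k * of_nat (N choose k) * Q k)"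
    using insert.hyps unfolding sum_distrib_left sum.distrib[symmetric]
    by (intro sum.cong) (auto simp: Q_def algebra_simps)
  also have "(\<Sum>k\<le>N. (- 1) ^ k * of_nat (N choose k) * Q k) = 0"
    using insert.IH[of N f] N unfolding Q_def by simp
  also have "(\<Sum>k\<le>N. (- 1) ^ k * of_nat (N choose k) * of_nat k * Q k) =
     - of_nat (Suc M) * (if card A = M then (- 1) ^ M * of_nat (fact M) else 0)"
    unfolding N(1) shift using insert.IH[OF N(2)] by simp
  also have "- of_nat (Suc M) * (if card A = M then (- 1) ^ M * of_nat (fact M) else 0) + f a * 0 =
      (if card (insert a A) = N then (- 1) ^ N * of_nat (fact N) else (0::'a))"
    using insert.hyps N by (simp add: algebra_simps)
  finally show ?case .
qed

context
  fixes p :: nat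
  assumes prime: "Factorial_Ring.prime p"
begin

text \<open>Pascal's rule and \<open>p dvd (p choose Suc k)\<close> make consecutive signed
  coefficients congruent.\<close>

lemma choose_prime_minus_one_cong:
  assumes "k < p"
  shows "[(- 1) ^ k * int (p - 1 choose k) = 1] (mod int p)"
  using assms
proof (induction k)
  case 0
  show ?case by simp
next
  case (Suc k)
  have "p dvd (p choose Suc k)" using dvd_choose_prime[of "Suc k" p] Suc.prems prime by simp
  moreover have "p choose Suc k = (p - 1 choose k) + (p - 1 choose Suc k)"
    using Suc.prems by (cases p) auto
  ultimately have "int p dvd int (p - 1 choose k) + int (p - 1 choose Suc k)"
    by (metis int_dvd_int_iff of_nat_add)
  hence "int p dvd (- 1) ^ Suc k * (int (p - 1 choose k) + int (p - 1 choose Suc k))"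
    by (rule dvd_mult)
  also have "(- 1) ^ Suc k * (int (p - 1 choose k) + int (p - 1 choose Suc k)) =
      (- 1) ^ Suc k * int (p - 1 choose Suc k) - (- 1) ^ k * int (p - 1 choose k)"
    by (simp add: algebra_simps)
  finally have "int p dvd (- 1) ^ Suc k * int (p - 1 choose Suc k) - (- 1) ^ k * int (p - 1 choose k)" .
  hence "[(- 1) ^ Suc k * int (p - 1 choose Suc k) = (- 1) ^ k * int (p - 1 choose k)] (mod int p)"
    by (simp add: cong_iff_dvd_diff)
  thus ?case using Suc by (meson Suc_lessD cong_trans)
qed

text \<open>Modulo \<open>p\<close> the plain sum over a complete residue system is the
  \<open>(p - 1)\<close>-st finite difference, which kills polynomials of degree below
  \<open>p - 1\<close>.\<close>

lemma sum_prod_linear_cong_0: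
  fixes f :: "'i \<Rightarrow> int"
  assumes "finite A" "card A < p - 1"
  shows "[(\<Sum>k<p. \<Prod>i\<in>A. int k + f i) = 0] (mod int p)"
proof -
  have "{..<p} = {..p - 1}" using prime_gt_0_nat[OF prime] by auto
  moreover have "[(\<Sum>k\<le>p - 1. 1 * (\<Prod>i\<in>A. int k + f i)) =
    (\<Sum>k\<le>p - 1. (- 1) ^ k * int (p - 1 choose k) * (\<Prod>i\<in>A. int k + f i))] (mod int p)"
    using prime_gt_0_nat[OF prime]
    by (intro cong_sum cong_mult cong_refl cong_sym[OF choose_prime_minus_one_cong]) auto
  ultimately show ?thesis using alternating_binomial_prod[OF assms(1), of "p - 1" f] assms(2) by simp
qed

lemma sum_powers_cong_0:
  assumes "0 < e" "e < p - 1"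
  shows "[(\<Sum>l=1..p-1. int l ^ e) = 0] (mod int p)"
proof -
  have "{..<p} = insert 0 {1..p-1}" using prime_gt_0_nat[OF prime] by auto
  hence "(\<Sum>l<p. int l ^ e) = (\<Sum>l=1..p-1. int l ^ e)" using assms by simp
  thus ?thesis using sum_prod_linear_cong_0[of "{..<e}" "\<lambda>_. 0"] assms by simp
qed

text \<open>This form of Fermat's theorem covers multiples of \<open>p\<close> as well, so exponents
  can be lowered without a case distinction.\<close>

lemma fermat_int: "[x ^ p = x] (mod int p)"
proof (cases "int p dvd x")
  case True
  hence "int p dvd x ^ p" using prime_gt_0_nat[OF prime] by (meson dvd_power dvd_trans dvd_power_same)
  thus ?thesis using True by (simp add: cong_iff_dvd_diff)
next
  case False
  define y where "y = nat (x mod int p)"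
  have "p > 0" using prime_gt_0_nat[OF prime] .
  hence y: "[int y = x] (mod int p)" by (simp add: y_def)
  hence "\<not> int p dvd int y" using False cong_dvd_iff[OF y] by blast
  hence "\<not> p dvd y" by (simp add: int_dvd_int_iff)
  hence "[y ^ (p - 1) = 1] (mod p)" using fermat_theorem[OF prime] by blast
  hence "[y * y ^ (p - 1) = y * 1] (mod p)" by (rule cong_scalar_left)
  hence "[y ^ p = y] (mod p)" using \<open>p > 0\<close> by (cases p) auto
  hence "[int y ^ p = int y] (mod int p)" by (metis cong_int_iff of_nat_power)
  thus ?thesis using y by (meson cong_pow cong_sym cong_trans)
qed

text \<open>
  The reflection \<open>k \<mapsto> p - 1 + m - k\<close> preserves the \<open>n\<close>-th power of the falling
  factorial modulo \<open>p\<close> and turns the harmonic-type sum at \<open>k\<close> into the negative of the one at \<open>k - m\<close>. So twice the sum is a sum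
  of polynomials in \<open>k\<close> of degree \<open>p - 3\<close> over a complete residue system.
\<close>

lemma sum_falling_harmonic_cong_0:
  fixes n m :: nat
  assumes "n \<ge> 3" "n * m = p - 1"
  shows "[(\<Sum>k<p. (\<Prod>j<m. int k - int j) ^ n * (\<Sum>l=1..k. int l ^ (p - 3))) = 0] (mod int p)"
proof -
  have m: "m > 0" using prime_gt_1_nat[OF prime] assms(2) by (cases m) auto
  hence "n * 1 \<le> n * m" by (intro mult_le_mono2) simp
  hence p: "p \<ge> 4" using assms by linarith
  have "p \<noteq> 4" using prime prime_odd_nat[of p] by auto
  with p have p5: "p \<ge> 5" by simp
  have odd: "odd p" using prime p by (simp add: prime_odd_nat)
  define g where "g k = (\<Prod>j<m. int k - int j)" for k :: nat
  \<comment> \<open>By Fermat, \<open>l ^ (p - 3)\<close> is an integer stand-in for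
    \<open>1 / l ^ 2\<close> modulo \<open>p\<close>.\<close>
  define h where "h k = (\<Sum>l=1..k. int l ^ (p - 3))" for k :: nat
  have h_Suc: "h (Suc k) = h k + int (Suc k) ^ (p - 3)" for k by (simp add: h_def)
  have mp: "m \<le> p - 1" using assms using mult_le_mono1[of 1 n m] by simp
  have h_refl: "[h (p - 1 - i) = - h i] (mod int p)" if "i \<le> p - 1" for i
    using that
  proof (induction i)
    case 0
    show ?case using sum_powers_cong_0[of "p - 3"] p5 by (simp add: h_def)
  next
    case (Suc i)
    define c where "c = p - 1 - Suc i"
    have c: "p - 1 - i = Suc c" "int (Suc c) = int p - int (Suc i)" using Suc.prems c_def by auto
    have "[int (Suc c) = - int (Suc i)] (mod int p)" unfolding c(2) by (simp add: cong_iff_dvd_diff)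
    hence "[int (Suc c) ^ (p - 3) = (- int (Suc i)) ^ (p - 3)] (mod int p)" by (rule cong_pow)
    also have "(- int (Suc i)) ^ (p - 3) = int (Suc i) ^ (p - 3)"
      using odd p by (intro power_minus_even) simp
    finally have *: "[int (Suc c) ^ (p - 3) = int (Suc i) ^ (p - 3)] (mod int p)" .
    have "[h (Suc c) = - h i] (mod int p)" using Suc c(1) by simp
    from cong_diff[OF this *] have "[h c = - h (Suc i)] (mod int p)" unfolding h_Suc by simp
    thus ?case unfolding c_def .
  qed
  \<comment> \<open>The zeros of \<open>g\<close> below \<open>m\<close> cut the range down to
    \<open>{m..<p}\<close>, which the reflection maps onto itself.\<close>
  have g0: "g k = 0" if "k < m" for k unfolding g_def using that by (intro prod_zero) auto
  have restrict: "(\<Sum>k<p. g k ^ n * F k) = (\<Sum>k\<in>{m..<p}. g k ^ n * F k)" for F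
    using assms(1) by (intro sum.mono_neutral_right) (auto simp: g0 not_le)
  have g_refl: "[g (p - 1 + m - k) ^ n = g k ^ n] (mod int p)" if "k \<in> {m..<p}" for k
  proof -
    have "(\<Prod>j<m. int m - 1 - int j - int k) = (\<Prod>j<m. int j - int k)"
      by (rule prod.reindex_bij_witness[of _ "\<lambda>j. m - 1 - j" "\<lambda>j. m - 1 - j"]) auto
    also have "\<dots> = (\<Prod>j<m. (- 1) * (int k - int j))" by simp
    also have "\<dots> = (- 1) ^ m * g k" unfolding g_def prod.distrib by simp
    finally have eq: "(\<Prod>j<m. int m - 1 - int j - int k) = (- 1) ^ m * g k" .
    have "[g (p - 1 + m - k) = (\<Prod>j<m. int m - 1 - int j - int k)] (mod int p)"
      unfolding g_def using that p by (intro cong_prod) (auto simp: cong_iff_dvd_diff of_nat_diff)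
    hence "[g (p - 1 + m - k) ^ n = ((- 1) ^ m * g k) ^ n] (mod int p)" unfolding eq by (rule cong_pow)
    moreover have "((- 1) ^ m * g k) ^ n = (- 1) ^ (n * m) * g k ^ n"
      by (simp add: power_mult_distrib power_mult[symmetric] mult.commute)
    moreover have "even (n * m)" unfolding assms(2) using odd by simp
    ultimately show ?thesis by simp
  qed
  define T where "T = (\<Sum>k<p. g k ^ n * h k)"
  have "T = (\<Sum>k\<in>{m..<p}. g (p - 1 + m - k) ^ n * h (p - 1 + m - k))"
    unfolding T_def restrict
    by (rule sum.reindex_bij_witness[of _ "\<lambda>k. p - 1 + m - k" "\<lambda>k. p - 1 + m - k"]) auto
  also have "[\<dots> = (\<Sum>k\<in>{m..<p}. g k ^ n * (- h (k - m)))] (mod int p)"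
  proof (intro cong_sum cong_mult g_refl)
    fix k assume "k \<in> {m..<p}"
    thus "[h (p - 1 + m - k) = - h (k - m)] (mod int p)" using h_refl[of "k - m"] by auto
  qed
  finally have "[T + T = T + (\<Sum>k\<in>{m..<p}. g k ^ n * (- h (k - m)))] (mod int p)"
    by (rule cong_add[OF cong_refl])
  also have "T + (\<Sum>k\<in>{m..<p}. g k ^ n * (- h (k - m))) = (\<Sum>k\<in>{m..<p}. g k ^ n * (h k - h (k - m)))"
    unfolding T_def restrict by (simp add: sum.distrib[symmetric] algebra_simps)
  also have "\<dots> = (\<Sum>k\<in>{m..<p}. g k ^ n * (\<Sum>j<m. (int k - int j) ^ (p - 3)))"
  proof (intro sum.cong refl arg_cong2[where f = "(*)"])
    fix k assume k: "k \<in> {m..<p}"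
    have "h k - h (k - i) = (\<Sum>j<i. (int k - int j) ^ (p - 3))" if "i \<le> m" for i
      using that
    proof (induction i)
      case (Suc i)
      define c where "c = k - Suc i"
      have "k - i = Suc c" "int (Suc c) = int k - int i" using Suc.prems k by (auto simp: c_def)
      thus ?case using Suc h_Suc[of c] unfolding c_def[symmetric] by simp
    qed simp
    thus "h k - h (k - m) = (\<Sum>j<m. (int k - int j) ^ (p - 3))" by simp
  qed
  also have "\<dots> = (\<Sum>j<m. \<Sum>k<p. g k ^ n * (int k - int j) ^ (p - 3))"
    by (subst restrict[symmetric]) (simp only: sum_distrib_left, rule sum.swap)
  also have "[\<dots> = (\<Sum>j<m. 0)] (mod int p)"
  proof (intro cong_sum)
    fix j assume j: "j \<in> {..<m}"
    \<comment> \<open>\<open>A\<close> lists linear factors with multiplicity; the second component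
      only counts copies. Fermat lowers the exponent of \<open>k - j\<close> from
      \<open>n + p - 3\<close> to \<open>n - 2\<close>, which leaves the degree
      \<open>(m - 1) * n + (n - 2) = p - 3\<close>.\<close>
    define A where "A = ({..<m} - {j}) \<times> {..<n} \<union> {j} \<times> {..<n - 2}"
    have A: "(\<Prod>i\<in>A. int k + (- int (fst i))) =
      (\<Prod>i\<in>{..<m} - {j}. int k - int i) ^ n * (int k - int j) ^ (n - 2)" for k
      unfolding A_def
      by (subst prod.union_disjoint) (auto simp: prod.Sigma[symmetric] prod_power_distrib
          split_beta prod.cartesian_product' )
    have "card A = (m - 1) * n + (n - 2)"
      unfolding A_def using j by (subst card_Un_disjoint) auto
    also have "\<dots> < p - 1" unfolding assms(2)[symmetric] using m assms(1)
      by (cases m) (auto simp: algebra_simps)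
    finally have cardA: "card A < p - 1" .
    have "[(\<Sum>k<p. g k ^ n * (int k - int j) ^ (p - 3)) = (\<Sum>k<p. \<Prod>i\<in>A. int k + (- int (fst i)))] (mod int p)"
    proof (intro cong_sum)
      fix k
      define R where "R = (\<Prod>i\<in>{..<m} - {j}. int k - int i)"
      define x where "x = int k - int j"
      have g: "g k = x * R" unfolding g_def R_def x_def using j by (simp add: prod.remove)
      have "x ^ n * x ^ (p - 3) = x ^ p * x ^ (n - 3)"
        using assms(1) p by (simp add: power_add[symmetric] add.commute)
      also have "[\<dots> = x * x ^ (n - 3)] (mod int p)" by (intro cong_mult fermat_int cong_refl)
      also have "x * x ^ (n - 3) = x ^ (n - 2)"
        using assms(1) by (metis Suc_diff_le diff_Suc_Suc eval_nat_numeral(3) power_Suc)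
      finally have "[R ^ n * (x ^ n * x ^ (p - 3)) = R ^ n * x ^ (n - 2)] (mod int p)"
        by (rule cong_scalar_left)
      thus "[g k ^ n * (int k - int j) ^ (p - 3) = (\<Prod>i\<in>A. int k + (- int (fst i)))] (mod int p)"
        unfolding A g x_def[symmetric] R_def[symmetric] by (simp add: power_mult_distrib mult_ac)
    qed
    also have "[(\<Sum>k<p. \<Prod>i\<in>A. int k + (- int (fst i))) = 0] (mod int p)"
      by (rule sum_prod_linear_cong_0[OF _ cardA]) (auto simp: A_def)
    finally show "[(\<Sum>k<p. g k ^ n * (int k - int j) ^ (p - 3)) = 0] (mod int p)" .
  qed
  finally have "int p dvd 2 * T" by (simp add: cong_0_iff)
  moreover have "\<not> int p dvd 2" using p by (auto dest: zdvd_imp_le)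
  ultimately have "int p dvd T" using prime prime_dvd_mult_iff[of "int p" 2 T] by simp
  thus ?thesis unfolding T_def g_def h_def by (simp add: cong_0_iff)
qed

end

section \<open>The p-adic Gamma function\<close>

lemma Gamma_p_nat_0 [simp]: "Gamma_p_nat p 0 = 1"
  by (simp add: Gamma_p_nat_def)

lemma Gamma_p_nat_Suc:
  "Gamma_p_nat p (Suc N) = Gamma_p_nat p N * (if p dvd N then - 1 else - int N)"
proof -
  have "{k. 1 \<le> k \<and> k < Suc N \<and> \<not> p dvd k} =
    (if p dvd N then {k. 1 \<le> k \<and> k < N \<and> \<not> p dvd k} else insert N {k. 1 \<le> k \<and> k < N \<and> \<not> p dvd k})"
    by (cases "N = 0") (auto simp: less_Suc_eq)
  thus ?thesis by (simp add: Gamma_p_nat_def)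
qed

lemma Gamma_p_nat_add:
  assumes "\<And>i. i < j \<Longrightarrow> \<not> p dvd N + i"
  shows "Gamma_p_nat p (N + j) = Gamma_p_nat p N * (- 1) ^ j * (\<Prod>i<j. int (N + i))"
  using assms by (induction j) (simp_all add: Gamma_p_nat_Suc algebra_simps)

section \<open>Residues of rational numbers and divisibility in the p-adic integers\<close>

context
  fixes p :: nat
  assumes prime: "Factorial_Ring.prime p"
begin

lemma padic_nonneg:
  assumes "x \<in> carrier (padic_ring p)"
  shows "x k \<ge> 0"
proof -
  have "x k mod int p ^ k \<ge> 0" using prime_gt_0_nat[OF prime] by simp
  thus ?thesis using padic_coherent[OF assms prime_gt_0_nat[OF prime], of k k] by simp
qed

text \<open>The reduced modular inverses of the denominator are unique, hence coherent, and so form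
  its inverse in the ring. The second claim determines each residue by a congruence free of
  inverses.\<close>

lemma padic_of_rat:
  assumes "p_integral p q"
  shows "padic_of_rat p q \<in> carrier (padic_ring p)"
    and "[snd (quotient_of q) * padic_of_rat p q k = fst (quotient_of q)] (mod int p ^ k)"
proof -
  have p: "p > 0" using prime_gt_0_nat[OF prime] .
  interpret cring "padic_ring p" by (rule padic_ring_cring[OF p])
  define a d where "a = fst (quotient_of q)" and "d = snd (quotient_of q)"
  have "\<not> int p dvd d" using assms by (simp add: p_integral_def d_def)
  hence "coprime (int p) d" using prime by (intro prime_imp_coprime) auto
  hence cop: "coprime d (int p ^ k)" for k by (simp add: coprime_commute)
  define v where "v k = modular_inverse (int p ^ k) d" for k
  have dv: "[d * v k = 1] (mod int p ^ k)" for k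
    unfolding v_def by (rule cong_modular_inverse1[OF cop])
  have "v (Suc k) mod int p ^ k = v k" for k
  proof -
    have "[d * v (Suc k) = 1] (mod int p ^ k)"
      using dv[of "Suc k"] by (rule cong_dvd_modulus) simp
    hence "[d * (v (Suc k) mod int p ^ k) = 1] (mod int p ^ k)"
      by (simp add: cong_def mod_mult_right_eq)
    thus ?thesis unfolding v_def[of k]
      using p by (intro modular_inverse_int_eqI[symmetric]) auto
  qed
  hence v: "v \<in> carrier (padic_ring p)" by (simp add: padic_ring_def)
  have "padic_of_int p d \<otimes>\<^bsub>padic_ring p\<^esub> v = \<one>\<^bsub>padic_ring p\<^esub>"
    using dv by (simp add: padic_ring_def padic_of_int_def cong_def mod_mult_left_eq)
  hence "inv\<^bsub>padic_ring p\<^esub> padic_of_int p d = v"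
    using comm_inv_char[OF padic_of_int_closed v] by blast
  hence eq: "padic_of_rat p q = padic_of_int p a \<otimes>\<^bsub>padic_ring p\<^esub> v"
    by (simp add: padic_of_rat_def a_def d_def)
  thus "padic_of_rat p q \<in> carrier (padic_ring p)" using v padic_of_int_closed by simp
  have "padic_of_rat p q k = a * v k mod int p ^ k"
    unfolding eq by (simp add: padic_ring_def padic_of_int_def mod_mult_left_eq)
  hence "[d * padic_of_rat p q k = a * (d * v k)] (mod int p ^ k)"
    by (simp add: cong_def mod_mult_right_eq mult.left_commute)
  also have "[a * (d * v k) = a * 1] (mod int p ^ k)" by (intro cong_scalar_left dv)
  finally show "[snd (quotient_of q) * padic_of_rat p q k = fst (quotient_of q)] (mod int p ^ k)"
    by (simp add: a_def d_def)
qed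

lemma padic_pow_eval:
  "(x [^]\<^bsub>padic_ring p\<^esub> (j::nat)) k = x k ^ j mod int p ^ k"
proof (induction j)
  case 0
  show ?case by (simp add: padic_ring_def)
next
  case (Suc j)
  have "(x [^]\<^bsub>padic_ring p\<^esub> Suc j) k = (x [^]\<^bsub>padic_ring p\<^esub> j) k * x k mod int p ^ k"
    by (simp add: nat_pow_def) (simp add: padic_ring_def)
  also have "\<dots> = x k ^ Suc j mod int p ^ k"
    unfolding Suc mod_mult_left_eq by (simp add: mult.commute)
  finally show ?case .
qed

text \<open>Divisibility by \<open>p ^ m\<close> is decided by the single residue at index
  \<open>m\<close>, which turns the p-adic claim into an integer congruence.\<close>

lemma padic_cong_uminusI:
  assumes x: "x \<in> carrier (padic_ring p)" and y: "y \<in> carrier (padic_ring p)"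
    and "[x m + y m = 0] (mod int p ^ m)"
  shows "padic_cong p m x (\<ominus>\<^bsub>padic_ring p\<^esub> y)"
proof -
  have p: "p > 0" using prime_gt_0_nat[OF prime] .
  interpret cring "padic_ring p" by (rule padic_ring_cring[OF p])
  define z where "z = x \<oplus>\<^bsub>padic_ring p\<^esub> y"
  have z: "z \<in> carrier (padic_ring p)" using x y by (simp add: z_def)
  have "z m = 0" using assms(3) by (simp add: z_def padic_ring_def cong_def)
  \<comment> \<open>Division by \<open>p ^ m\<close> uses up \<open>m\<close> digits, so the residue
    at \<open>k\<close> is read from \<open>z\<close> at \<open>m + k\<close>.\<close>
  define c where "c k = z (m + k) div int p ^ m" for k
  have zc: "z (m + k) = int p ^ m * c k" for k
    using padic_coherent[OF z p, of m "m + k"] \<open>z m = 0\<close> by (auto simp: c_def)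
  have "c (Suc k) mod int p ^ k = c k" for k
  proof -
    have "int p ^ m * (c (Suc k) mod int p ^ k) = z (m + Suc k) mod int p ^ (m + k)"
      unfolding zc by (simp add: power_add)
    also have "\<dots> = int p ^ m * c k" using padic_coherent[OF z p, of "m + k" "m + Suc k"] zc by simp
    finally show ?thesis using p by simp
  qed
  hence c: "c \<in> carrier (padic_ring p)" by (simp add: padic_ring_def)
  have "z k = (padic_of_int p (int p ^ m) \<otimes>\<^bsub>padic_ring p\<^esub> c) k" for k
  proof -
    have "z k = z (m + k) mod int p ^ k" using padic_coherent[OF z p, of k "m + k"] by simp
    thus ?thesis unfolding zc by (simp add: padic_ring_def padic_of_int_def mod_mult_left_eq)
  qed
  hence "z = padic_of_int p (int p ^ m) \<otimes>\<^bsub>padic_ring p\<^esub> c" by blast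
  moreover have "x \<ominus>\<^bsub>padic_ring p\<^esub> (\<ominus>\<^bsub>padic_ring p\<^esub> y) = z"
    using x y by (simp add: z_def minus_eq)
  ultimately show ?thesis unfolding padic_cong_def factor_def using c by blast
qed

end

section \<open>The Gamma function at natural arguments and its p-adic continuity\<close>

context
  fixes p :: nat
  assumes prime: "Factorial_Ring.prime p" and odd: "odd p"
begin

text \<open>The arguments split into \<open>t\<close> blocks of length \<open>p\<close>. The
  multiple of \<open>p\<close> at the head of a block contributes \<open>-1\<close>; the other
  \<open>p - 1\<close> signs cancel because \<open>p\<close> is odd.\<close>

lemma Gamma_p_nat_mult:
  "Gamma_p_nat p (p * t) = (\<Prod>s<t. - (\<Prod>l=1..p-1. int p * int s + int l))"
proof (induction t)
  case (Suc s)
  have p: "p > 1" using prime_gt_1_nat[OF prime] .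
  have nd: "\<not> p dvd p * s + 1 + i" if "i < p - 1" for i
  proof -
    have "p * s + 1 + i = p * s + (i + 1)" by simp
    moreover have "\<not> p dvd i + 1" using that by (auto dest: dvd_imp_le)
    ultimately show ?thesis by (metis dvd_add_right_iff dvd_triv_left)
  qed
  have eq: "p * Suc s = p * s + 1 + (p - 1)" using p by simp
  have "Gamma_p_nat p (p * Suc s) =
    Gamma_p_nat p (p * s + 1) * (- 1) ^ (p - 1) * (\<Prod>i<p - 1. int (p * s + 1 + i))"
    unfolding eq by (rule Gamma_p_nat_add) (rule nd)
  also have "(\<Prod>i<p - 1. int (p * s + 1 + i)) = (\<Prod>l=1..p-1. int p * int s + int l)"
    by (rule prod.reindex_bij_witness[of _ "\<lambda>l. l - 1" "\<lambda>i. i + 1"]) auto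
  also have "Gamma_p_nat p (p * s + 1) * (- 1) ^ (p - 1) = - Gamma_p_nat p (p * s)"
    using odd p by (simp add: Gamma_p_nat_Suc)
  finally show ?case using Suc by simp
qed simp

text \<open>The product over each block reduces to \<open>(p - 1)!\<close>, which is
  \<open>-1\<close> by Wilson's theorem, and it carries a further minus sign.\<close>

lemma Gamma_p_nat_mult_cong_1: "[Gamma_p_nat p (p * t) = 1] (mod int p)"
proof -
  have "[(\<Prod>s<t. - (\<Prod>l=1..p-1. int p * int s + int l)) = (\<Prod>s<t. 1)] (mod int p)"
  proof (intro cong_prod)
    fix s
    have "[(\<Prod>l=1..p-1. int p * int s + int l) = (\<Prod>l=1..p-1. int l)] (mod int p)"
      by (intro cong_prod) (simp add: cong_iff_dvd_diff)
    also have "(\<Prod>l=1..p-1. int l) = fact (p - 1)" by (simp add: fact_prod)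
    also have "[fact (p - 1) = - 1] (mod int p)" using wilson_theorem[OF prime] by simp
    finally show "[- (\<Prod>l=1..p-1. int p * int s + int l) = 1] (mod int p)"
      by (metis cong_minus_minus_iff minus_minus)
  qed
  thus ?thesis unfolding Gamma_p_nat_mult by simp
qed

text \<open>
  Inversion permutes the units modulo \<open>p ^ k\<close>, so the square of their product is \<open>1\<close>; the sign is
  then determined modulo \<open>p\<close>.
\<close>

lemma Gamma_p_nat_prime_power:
  assumes "k > 0"
  shows "[Gamma_p_nat p (p ^ k) = 1] (mod int p ^ k)"
proof -
  define P where "P = int p ^ k"
  have P: "P > 0" unfolding P_def using prime_gt_0_nat[OF prime] by simp
  define V where "V = {x. 0 < x \<and> x < P \<and> coprime x P}"
  define G where "G = Gamma_p_nat p (p ^ k)"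
  have cop: "coprime (int j) P \<longleftrightarrow> \<not> p dvd j" for j
  proof -
    have "coprime (int j) P \<longleftrightarrow> coprime j p"
      unfolding P_def using assms by (simp add: coprime_power_right_iff coprime_int_iff)
    also have "\<dots> \<longleftrightarrow> \<not> p dvd j"
      using prime prime_imp_coprime[of p j] coprime_absorb_left coprime_commute
      by (metis not_prime_unit)
    finally show ?thesis .
  qed
  have eqP: "(\<Prod>j | 1 \<le> j \<and> j < p ^ k \<and> \<not> p dvd j. int j) = \<Prod>V"
  proof (rule prod.reindex_bij_witness[of _ nat int])
    fix x assume "x \<in> V"
    hence "coprime (int (nat x)) P" "0 < x" "nat x < p ^ k"
      unfolding V_def P_def by (auto simp: nat_less_iff)
    thus "nat x \<in> {j. 1 \<le> j \<and> j < p ^ k \<and> \<not> p dvd j}" "int (nat x) = x" unfolding cop by auto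
  next
    fix j assume "j \<in> {j. 1 \<le> j \<and> j < p ^ k \<and> \<not> p dvd j}"
    hence "0 < j" "j < p ^ k" "coprime (int j) P" unfolding cop by auto
    thus "int j \<in> V" unfolding V_def P_def by (metis (mono_tags) mem_Collect_eq of_nat_0_less_iff of_nat_less_iff of_nat_power)
  qed auto
  have inv: "modular_inverse P x \<in> V" "modular_inverse P (modular_inverse P x) = x" if "x \<in> V" for x
  proof -
    have x: "0 < x" "x < P" "coprime x P" using that by (auto simp: V_def)
    have "P > 1" using x by linarith
    thus "modular_inverse P x \<in> V" unfolding V_def
      using mult_modular_inverse_int_pos[of P x] modular_inverse_int_less[of P x]
        coprime_modular_inverse[of x P] x by (simp add: coprime_commute)
    show "modular_inverse P (modular_inverse P x) = x"
      using x cong_modular_inverse2[of x P] by (intro modular_inverse_int_eqI) auto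
  qed
  have "\<Prod>V = (\<Prod>x\<in>V. modular_inverse P x)"
    by (rule prod.reindex_bij_witness[of _ "modular_inverse P" "modular_inverse P"]) (auto simp: inv)
  hence "\<Prod>V * \<Prod>V = (\<Prod>x\<in>V. x * modular_inverse P x)" by (simp add: prod.distrib)
  also have "[\<dots> = (\<Prod>x\<in>V. 1)] (mod P)"
    by (intro cong_prod cong_modular_inverse1) (auto simp: V_def)
  finally have sq: "[\<Prod>V * \<Prod>V = 1] (mod P)" by simp
  have G: "G = - \<Prod>V" unfolding G_def Gamma_p_nat_def eqP using odd by simp
  hence "[G * G = 1] (mod P)" using sq by simp
  moreover have "G * G - 1 = (G + 1) * (G - 1)" by (simp add: algebra_simps)
  ultimately have dvd: "P dvd (G + 1) * (G - 1)" by (simp add: cong_iff_dvd_diff)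
  have "p ^ k = p * p ^ (k - 1)" using assms by (metis power_minus_mult mult.commute)
  hence "[G = 1] (mod int p)" unfolding G_def using Gamma_p_nat_mult_cong_1[of "p ^ (k - 1)"] by simp
  \<comment> \<open>\<open>G + 1\<close> is \<open>2\<close> modulo \<open>p\<close> and therefore a
    unit, so all of \<open>P\<close> divides the other factor \<open>G - 1\<close>.\<close>
  hence "[G + 1 = 1 + 1] (mod int p)" by (rule cong_add) simp
  moreover have "coprime 2 (int p)" using odd by simp
  ultimately have "coprime (G + 1) (int p)" by (metis cong_imp_coprime cong_sym one_add_one)
  hence "coprime P (G + 1)" unfolding P_def by (simp add: coprime_commute)
  hence "P dvd G - 1" using dvd by (simp add: coprime_dvd_mult_right_iff)
  thus ?thesis unfolding G_def P_def by (simp add: cong_iff_dvd_diff)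
qed

text \<open>For \<open>k > 0\<close> the value at \<open>p ^ k\<close> starts an induction by the
  functional equation: a shift by \<open>p ^ k\<close> changes neither the residue of the next
  factor nor whether \<open>p\<close> divides its argument.\<close>

lemma Gamma_p_nat_add_prime_power:
  "[Gamma_p_nat p (N + p ^ k * c) = Gamma_p_nat p N] (mod int p ^ k)"
proof (cases "k = 0")
  case False
  have step: "[Gamma_p_nat p (N + p ^ k) = Gamma_p_nat p N] (mod int p ^ k)" for N
  proof (induction N)
    case 0
    show ?case using Gamma_p_nat_prime_power False by simp
  next
    case (Suc N)
    have "p dvd p ^ k" using False by simp
    hence "p dvd N + p ^ k \<longleftrightarrow> p dvd N" by (simp add: dvd_add_left_iff)
    moreover have "[- int (N + p ^ k) = - int N] (mod int p ^ k)" by (simp add: cong_iff_dvd_diff)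
    ultimately have "[(if p dvd N + p ^ k then - 1 else - int (N + p ^ k)) =
      (if p dvd N then - 1 else - int N)] (mod int p ^ k)" by simp
    thus ?case unfolding add_Suc Gamma_p_nat_Suc by (rule cong_mult[OF Suc])
  qed
  show ?thesis
  proof (induction c)
    case (Suc c)
    have "N + p ^ k * Suc c = (N + p ^ k * c) + p ^ k" by simp
    thus ?case using step[of "N + p ^ k * c"] Suc cong_trans by metis
  qed simp
qed simp

text \<open>Uniform continuity in the p-adic sense, which is why the limit defining
  \<open>Gamma_p\<close> exists.\<close>

lemma Gamma_p_nat_cong:
  assumes "[N = N'] (mod p ^ k)"
  shows "[Gamma_p_nat p N = Gamma_p_nat p N'] (mod int p ^ k)"
proof -
  have "[Gamma_p_nat p N = Gamma_p_nat p (N mod p ^ k)] (mod int p ^ k)" for N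
    using Gamma_p_nat_add_prime_power[of "N mod p ^ k" k "N div p ^ k"] by simp
  thus ?thesis using assms unfolding cong_def by metis
qed

text \<open>By continuity the residue of the limit at \<open>k\<close> can be computed at the
  natural number \<open>x k\<close>; uniqueness of limits then evaluates the definite
  description.\<close>

lemma Gamma_p_eq:
  assumes x: "x \<in> carrier (padic_ring p)"
  shows "Gamma_p p x = (\<lambda>k. Gamma_p_nat p (nat (x k)) mod int p ^ k)" (is "_ = ?y")
    and "Gamma_p p x \<in> carrier (padic_ring p)"
proof -
  have p: "p > 0" using prime_gt_0_nat[OF prime] .
  have y: "?y \<in> carrier (padic_ring p)"
  proof -
    have "?y (Suc k) mod int p ^ k = ?y k" for k
    proof -
      have "x (Suc k) mod int p ^ k = x k" using padic_coherent[OF x p, of k "Suc k"] by simp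
      hence "[int (nat (x (Suc k))) = int (nat (x k))] (mod int p ^ k)"
        using padic_nonneg[OF prime x] padic_coherent[OF x p, of k k] by (simp add: cong_def)
      hence "[nat (x (Suc k)) = nat (x k)] (mod p ^ k)" by (metis cong_int_iff of_nat_power)
      hence "[Gamma_p_nat p (nat (x (Suc k))) = Gamma_p_nat p (nat (x k))] (mod int p ^ k)"
        by (rule Gamma_p_nat_cong)
      thus ?thesis by (simp add: cong_def mod_mod_cancel)
    qed
    thus ?thesis by (simp add: padic_ring_def)
  qed
  have lim: "is_padic_limit p (Gamma_p_nat p) x ?y"
    unfolding is_padic_limit_def
  proof (intro allI exI impI)
    \<comment> \<open>Continuity preserves precision, so \<open>M\<close> is taken to be
      \<open>m\<close>.\<close>
    fix m N
    assume "padic_of_int p (int N) m = x m"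
    hence "[int N = int (nat (x m))] (mod int p ^ m)"
      using padic_nonneg[OF prime x] padic_coherent[OF x p, of m m] by (simp add: cong_def padic_of_int_def)
    hence "[N = nat (x m)] (mod p ^ m)" by (metis cong_int_iff of_nat_power)
    hence "[Gamma_p_nat p N = Gamma_p_nat p (nat (x m))] (mod int p ^ m)"
      by (rule Gamma_p_nat_cong)
    thus "padic_of_int p (Gamma_p_nat p N) m = ?y m"
      by (simp add: padic_of_int_def cong_def)
  qed
  have "Gamma_p p x = ?y" unfolding Gamma_p_def
    using y lim is_padic_limit_unique[OF x p] by blast
  thus "Gamma_p p x = ?y" "Gamma_p p x \<in> carrier (padic_ring p)" using y by auto
qed

end

section \<open>Congruences modulo the cube of a prime\<close>

text \<open>Each factor \<open>x + l\<close> equals \<open>l * (1 + x / l)\<close>. For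
  \<open>x\<close> a multiple of \<open>p\<close> and \<open>k < p\<close>, this exhibits the ratio
  to \<open>k!\<close> as a product of factors that are \<open>1\<close> modulo
  \<open>p\<close>.\<close>

lemma pochhammer_one_plus:
  fixes x :: "'a::field_char_0"
  shows "pochhammer (1 + x) k = fact k * (\<Prod>l=1..k. 1 + x / of_nat l)"
proof (induction k)
  case (Suc k)
  have "1 + x + of_nat k = of_nat (Suc k) * (1 + x / of_nat (Suc k))"
    by (simp add: distrib_left del: of_nat_Suc) simp
  thus ?case using Suc by (simp add: pochhammer_Suc mult_ac del: of_nat_Suc)
qed simp

context
  fixes p :: nat
  assumes prime: "Factorial_Ring.prime p"
begin

text \<open>The denominator of the quotient is prime to \<open>p\<close> and cancels, so integer
  congruences can be recovered from rational ones.\<close>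

lemma rat_cong_of_int_iff: "rat_cong p r (of_int a) (of_int b) \<longleftrightarrow> [a = b] (mod int p ^ r)"
proof
  assume "rat_cong p r (of_int a) (of_int b)"
  then obtain q where "p_integral p q" "(of_int a - of_int b :: rat) = of_nat p ^ r * q"
    using rat_cong_def by blast
  then obtain c d where cd: "\<not> int p dvd d" "(of_int a - of_int b :: rat) = of_nat p ^ r * (of_int c / of_int d)"
    unfolding p_integral_iff[OF prime] by blast
  moreover have "d \<noteq> 0" using cd(1) by auto
  ultimately have "(of_int ((a - b) * d) :: rat) = of_int (int p ^ r * c)"
    by (simp add: field_simps)
  hence "(a - b) * d = int p ^ r * c" by linarith
  moreover have "coprime (int p ^ r) d"
    using cd(1) prime prime_imp_coprime[of "int p" d] by simp
  ultimately have "int p ^ r dvd a - b" by (metis coprime_dvd_mult_left_iff dvd_triv_left)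
  thus "[a = b] (mod int p ^ r)" by (simp add: cong_iff_dvd_diff)
qed (rule rat_cong_of_int[OF prime])

lemma rat_cong_p_multiple: "p_integral p q \<Longrightarrow> rat_cong p 1 (x + of_nat p * q) x"
  by (rule rat_congI[OF prime, of q]) auto

text \<open>Fermat's congruence for \<open>l ^ (p - 1)\<close> is divided by
  \<open>l ^ 2\<close>.\<close>

lemma rat_cong_inverse_square:
  assumes "0 < l" "l < p" "p \<ge> 3"
  shows "rat_cong p 1 ((1 / of_nat l)\<^sup>2) (of_int (int l ^ (p - 3)))"
proof -
  have nd: "\<not> p dvd l" using assms by (auto dest: dvd_imp_le)
  hence "[int (l ^ (p - 1)) = int 1] (mod int p)"
    using fermat_theorem[OF prime nd] by (subst cong_int_iff)
  hence "[int l ^ (p - 1) = 1] (mod int p ^ 1)" by simp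
  from rat_cong_of_int[OF prime this]
  have "rat_cong p 1 (of_nat l ^ (p - 1)) 1" by simp
  from rat_cong_scale0[OF prime this, of "(1 / of_nat l)\<^sup>2"]
  have "rat_cong p 1 ((1 / of_nat l)\<^sup>2 * of_nat l ^ (p - 1)) ((1 / of_nat l)\<^sup>2)"
    using p_integral_power[OF prime p_integral_inverse_nat[OF prime nd]] by simp
  moreover have "p - 1 = 2 + (p - 3)" using assms by simp
  hence "(of_nat l :: rat) ^ (p - 1) = of_nat l ^ 2 * of_nat l ^ (p - 3)" by (metis power_add)
  hence "(1 / of_nat l)\<^sup>2 * of_nat l ^ (p - 1) = (of_int (int l ^ (p - 3)) :: rat)"
    using assms(1) by (simp add: power_divide)
  ultimately show ?thesis using rat_cong_sym[OF prime] by metis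
qed

text \<open>All cross terms carry at least \<open>p ^ 4\<close>.\<close>

lemma rat_cong_prod_one_plus:
  assumes "\<And>i. i \<in> A \<Longrightarrow> p_integral p (c i)"
  shows "rat_cong p 3 (\<Prod>i\<in>A. 1 + of_nat p ^ 2 * c i) (1 + of_nat p ^ 2 * (\<Sum>i\<in>A. c i))"
  using assms
proof (induction A rule: infinite_finite_induct)
  case (insert a A)
  define C where "C = (\<Sum>i\<in>A. c i)"
  have C: "p_integral p C" "p_integral p (c a)"
    unfolding C_def using insert.prems by (auto intro: p_integral_sum[OF prime])
  have int: "p_integral p (1 + of_nat p ^ 2 * x)" if "p_integral p x" for x
    using that by (auto intro!: p_integral_intros[OF prime] p_integral_numeral[OF prime])
  have "rat_cong p 3 ((1 + of_nat p ^ 2 * c a) * (\<Prod>i\<in>A. 1 + of_nat p ^ 2 * c i))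
      ((1 + of_nat p ^ 2 * c a) * (1 + of_nat p ^ 2 * C))"
    using insert C int by (intro rat_cong_scale0[OF prime]) (auto simp: C_def)
  also have "rat_cong p 3 ((1 + of_nat p ^ 2 * c a) * (1 + of_nat p ^ 2 * C)) (1 + of_nat p ^ 2 * (c a + C))"
    using C by (intro rat_congI[OF prime, of "of_nat p * c a * C"] p_integral_mult[OF prime]
      p_integral_of_nat[OF prime]) (auto simp: algebra_simps eval_nat_numeral)
  finally (rat_cong_trans[OF prime]) show ?case using insert.hyps by (simp add: C_def)
qed (auto simp: rat_cong_refl[OF prime])

text \<open>Induction with Pascal's rule; each step discards only
  \<open>(n choose 2) * p ^ 3 * w ^ 3\<close>.\<close>

lemma rat_cong_binomial:
  assumes "p_integral p w"
  shows "rat_cong p 3 ((1 + of_nat p * w) ^ n)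
    (1 + of_nat n * of_nat p * w + of_nat (n choose 2) * of_nat p ^ 2 * w ^ 2)"
proof (induction n)
  case (Suc n)
  let ?r = "1 + of_nat n * of_nat p * w + of_nat (n choose 2) * of_nat p ^ 2 * w ^ 2"
  have "rat_cong p 3 ((1 + of_nat p * w) * (1 + of_nat p * w) ^ n) ((1 + of_nat p * w) * ?r)"
    using assms Suc by (intro rat_cong_scale0[OF prime])
      (auto intro!: p_integral_intros[OF prime] p_integral_numeral[OF prime])
  also have "Suc n choose 2 = n + (n choose 2)" by (simp add: eval_nat_numeral)
  hence "rat_cong p 3 ((1 + of_nat p * w) * ?r)
    (1 + of_nat (Suc n) * of_nat p * w + of_nat (Suc n choose 2) * of_nat p ^ 2 * w ^ 2)"
    using assms by (intro rat_congI[OF prime, of "of_nat (n choose 2) * w ^ 3"])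
      (auto intro!: p_integral_intros[OF prime] simp: algebra_simps power2_eq_square power3_eq_cube)
  finally (rat_cong_trans[OF prime]) show ?case by simp
qed (simp add: rat_cong_refl[OF prime] binomial_eq_0)

text \<open>
  Pairing \<open>l\<close> with \<open>p - l\<close> in the square of the product gives factors
  \<open>l * (p - l) + p\<^sup>2 * s * (s + 1)\<close>, and the sum of \<open>1 / (l * (p - l))\<close> is divisible by \<open>p\<close>.
\<close>

lemma prod_shifted_units_cong:
  assumes p5: "p \<ge> 5"
  shows "[(\<Prod>l=1..p-1. int p * int s + int l) = fact (p - 1)] (mod int p ^ 3)"
proof -
  define Z where "Z = (\<Prod>l=1..p-1. int p * int s + int l)"
  define Y where "Y = (fact (p - 1) :: int)"
  define c where "c = (of_nat (s * (s + 1)) :: rat)"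
  define d where "d l = c * (1 / of_nat l * (1 / of_nat (p - l)))" for l
  have Y: "Y = (\<Prod>l=1..p-1. int l)" unfolding Y_def by (simp add: fact_prod)
  have ZY: "[Z = Y] (mod int p)"
    unfolding Z_def Y by (intro cong_prod) (simp add: cong_iff_dvd_diff)
  have inv: "p_integral p (1 / of_nat l)" if "l \<in> {1..p-1}" for l
    using that by (intro p_integral_inverse_nat[OF prime]) (auto dest: dvd_imp_le)
  have inv': "p_integral p (1 / of_nat (p - l))" if "l \<in> {1..p-1}" for l
    using that by (intro inv) auto
  have reflect: "(\<Prod>l=1..p-1. f (p - l)) = (\<Prod>l=1..p-1. f l)" for f :: "nat \<Rightarrow> rat"
    by (rule prod.reindex_bij_witness[of _ "\<lambda>l. p - l" "\<lambda>l. p - l"]) auto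
  have "(of_int Z :: rat)\<^sup>2 = (\<Prod>l=1..p-1. of_nat p * of_nat s + of_nat l) *
      (\<Prod>l=1..p-1. of_nat p * of_nat s + of_nat (p - l))"
    unfolding reflect[of "\<lambda>l. of_nat p * of_nat s + of_nat l"] by (simp add: Z_def power2_eq_square)
  also have "\<dots> = (\<Prod>l=1..p-1. (of_nat l * of_nat (p - l)) * (1 + of_nat p ^ 2 * d l))"
    unfolding prod.distrib[symmetric]
  proof (rule prod.cong[OF refl])
    fix l assume l: "l \<in> {1..p-1}"
    define z where "z = p - l"
    have "p = l + z" "l > 0" "z > 0" using l by (auto simp: z_def)
    thus "(of_nat p * of_nat s + of_nat l) * (of_nat p * of_nat s + of_nat (p - l)) =
      (of_nat l * of_nat (p - l) * (1 + (of_nat p)\<^sup>2 * d l) :: rat)"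
      unfolding d_def c_def z_def[symmetric] by (simp add: field_simps power2_eq_square)
  qed
  also have "\<dots> = (of_int Y)\<^sup>2 * (\<Prod>l=1..p-1. 1 + of_nat p ^ 2 * d l)"
    unfolding prod.distrib reflect[of of_nat] by (simp add: Y power2_eq_square)
  finally have Z2: "(of_int Z :: rat)\<^sup>2 = (of_int Y)\<^sup>2 * (\<Prod>l=1..p-1. 1 + of_nat p ^ 2 * d l)" .
  have c: "p_integral p c" unfolding c_def by (rule p_integral_of_nat[OF prime])
  have dint: "p_integral p (d l)" if "l \<in> {1..p-1}" for l
    unfolding d_def using c inv[OF that] inv'[OF that] by (intro p_integral_mult[OF prime])
  \<comment> \<open>Since \<open>p - l\<close> is \<open>- l\<close> modulo \<open>p\<close>, the
    term \<open>d l\<close> becomes \<open>- c / l ^ 2\<close>, and the sum becomes a power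
    sum.\<close>
  have "rat_cong p 1 (d l) (- c * of_int (int l ^ (p - 3)))" if l: "l \<in> {1..p-1}" for l
  proof -
    have "rat_cong p 1 (- c * (1 / of_nat l)\<^sup>2) (- c * of_int (int l ^ (p - 3)))"
      using l p5 c by (intro rat_cong_scale0[OF prime] rat_cong_inverse_square
        p_integral_uminus[OF prime]) auto
    moreover have "rat_cong p 1 (d l) (- c * (1 / of_nat l)\<^sup>2)"
    proof (rule rat_congI[OF prime])
      define z where "z = p - l"
      have "p = l + z" "l > 0" "z > 0" using l by (auto simp: z_def)
      thus "d l - - c * (1 / of_nat l)\<^sup>2 = of_nat p ^ 1 * (c * (1 / of_nat l)\<^sup>2 * (1 / of_nat (p - l)))"
        unfolding d_def z_def[symmetric] by (simp add: field_simps power2_eq_square)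
      show "p_integral p (c * (1 / of_nat l)\<^sup>2 * (1 / of_nat (p - l)))"
        using c inv[OF l] inv'[OF l] by (intro p_integral_mult[OF prime] p_integral_power[OF prime])
    qed
    ultimately show ?thesis using rat_cong_trans[OF prime] by blast
  qed
  hence "rat_cong p 1 (\<Sum>l=1..p-1. d l) (\<Sum>l=1..p-1. - c * of_int (int l ^ (p - 3)))"
    by (rule rat_cong_sum[OF prime])
  also have "(\<Sum>l=1..p-1. - c * of_int (int l ^ (p - 3))) = - c * of_int (\<Sum>l=1..p-1. int l ^ (p - 3))"
    by (simp add: sum_distrib_left sum_negf)
  also have "rat_cong p 1 \<dots> (- c * of_int 0)"
    using sum_powers_cong_0[OF prime, of "p - 3"] p5 c
    by (intro rat_cong_scale0[OF prime] rat_cong_of_int[OF prime] p_integral_uminus[OF prime]) auto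
  finally (rat_cong_trans[OF prime]) have "rat_cong p 1 (\<Sum>l=1..p-1. d l) 0" by simp
  from rat_cong_scale[OF prime this, of 1 2]
  have "rat_cong p 3 (of_nat p ^ 2 * (\<Sum>l=1..p-1. d l)) 0"
    using p_integral_numeral[OF prime] by (simp add: eval_nat_numeral)
  from rat_cong_add[OF prime rat_cong_refl[OF prime] this, of 1]
  have "rat_cong p 3 (1 + of_nat p ^ 2 * (\<Sum>l=1..p-1. d l)) 1" by simp
  from rat_cong_trans[OF prime rat_cong_prod_one_plus[OF dint] this]
  have "rat_cong p 3 (\<Prod>l=1..p-1. 1 + of_nat p ^ 2 * d l) 1" by simp
  from rat_cong_scale0[OF prime this, of "(of_int Y)\<^sup>2"]
  have "rat_cong p 3 (of_int (Z\<^sup>2)) (of_int (Y\<^sup>2))"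
    using Z2 p_integral_power[OF prime p_integral_of_int[OF prime]] by simp
  hence "[Z\<^sup>2 = Y\<^sup>2] (mod int p ^ 3)" unfolding rat_cong_of_int_iff .
  hence "int p ^ 3 dvd (Z + Y) * (Z - Y)" by (simp add: cong_iff_dvd_diff power2_eq_square algebra_simps)
  \<comment> \<open>\<open>Z + Y\<close> is \<open>2 * Y\<close> modulo \<open>p\<close>, a unit, so
    equality of the squares forces \<open>Z\<close> and \<open>Y\<close> themselves to
    agree.\<close>
  moreover have "coprime (Z + Y) (int p)"
  proof -
    have "\<not> p dvd fact (p - 1)" using prime p5 by (simp add: prime_dvd_fact_iff)
    hence "\<not> int p dvd Y" unfolding Y_def by (metis int_dvd_int_iff of_nat_fact)
    moreover have "\<not> int p dvd 2" using p5 by (auto dest: zdvd_imp_le)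
    ultimately have "\<not> int p dvd 2 * Y" using prime by (simp add: prime_dvd_mult_iff)
    hence "coprime (2 * Y) (int p)" using prime
      by (metis coprime_commute of_nat_dvd_iff prime_imp_coprime prime_nat_int_transfer)
    moreover have "[2 * Y = Z + Y] (mod int p)" using cong_add[OF cong_sym[OF ZY] cong_refl[of Y]] by simp
    ultimately show ?thesis using cong_imp_coprime by blast
  qed
  ultimately have "int p ^ 3 dvd Z - Y"
    by (metis coprime_commute coprime_dvd_mult_right_iff coprime_power_left_iff)
  thus ?thesis unfolding Z_def Y_def by (simp add: cong_iff_dvd_diff)
qed

text \<open>In \<open>x ^ p - 1 = (x - 1) * (\<Sum>i<p. x ^ i)\<close> the second factor is a sum of
  \<open>p\<close> terms congruent to \<open>1\<close>, hence divisible by \<open>p\<close>.\<close>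

lemma cong_power_prime:
  assumes "[x = 1] (mod int p ^ r)" "r > 0"
  shows "[x ^ p = 1] (mod int p ^ Suc r)"
proof -
  have "[x = 1] (mod int p)" using assms by (meson cong_dvd_modulus dvd_power)
  hence "[(\<Sum>i<p. x ^ i) = (\<Sum>i<p. 1 ^ i)] (mod int p)" by (intro cong_sum cong_pow)
  hence "int p dvd (\<Sum>i<p. x ^ i)" using cong_dvd_iff by fastforce
  moreover have "int p ^ r dvd x - 1" using assms(1) by (simp add: cong_iff_dvd_diff)
  ultimately have "int p ^ r * int p dvd (x - 1) * (\<Sum>i<p. x ^ i)" by (intro mult_dvd_mono)
  thus ?thesis by (simp add: cong_iff_dvd_diff power_diff_1_eq mult.commute)
qed

text \<open>Each of the \<open>t\<close> blocks contributes \<open>y = - (p - 1)!\<close> modulo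
  \<open>p ^ 3\<close>. By Wilson \<open>y\<close> is \<open>1\<close> modulo \<open>p\<close>, so
  its \<open>p ^ 2\<close>-th power is \<open>1\<close> modulo \<open>p ^ 3\<close>, and the
  exponent \<open>n * t\<close> can be reduced modulo \<open>p ^ 2\<close>.\<close>

lemma Gamma_p_nat_power_cong:
  assumes p5: "p \<ge> 5" and tn: "[n * t = 1] (mod p ^ 2)"
  shows "[Gamma_p_nat p (p * t) ^ n = - fact (p - 1)] (mod int p ^ 3)"
proof -
  have odd: "odd p" using prime p5 by (simp add: prime_odd_nat)
  define y where "y = - (fact (p - 1) :: int)"
  have "[Gamma_p_nat p (p * t) = (\<Prod>s<t. y)] (mod int p ^ 3)"
    unfolding Gamma_p_nat_mult[OF prime odd] y_def
    by (intro cong_prod) (simp only: cong_minus_minus_iff prod_shifted_units_cong[OF p5])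
  hence "[Gamma_p_nat p (p * t) ^ n = (y ^ t) ^ n] (mod int p ^ 3)" by (intro cong_pow) simp
  moreover have "(y ^ t) ^ n = y ^ (n * t)" by (simp add: power_mult[symmetric] mult.commute)
  moreover have "[y ^ (n * t) = y] (mod int p ^ 3)"
  proof -
    have "n * t \<noteq> 0"
    proof
      assume "n * t = 0"
      hence "[1 = 0] (mod p ^ 2)" using tn by (simp only: cong_sym_eq)
      hence "p ^ 2 dvd 1" by (simp only: cong_0_iff)
      thus False using p5 by simp
    qed
    then obtain c where c: "n * t = 1 + p ^ 2 * c"
      using tn cong_le_nat[of 1 "n * t" "p ^ 2"] by (auto simp: cong_sym_eq mult.commute)
    have "[y = 1] (mod int p ^ 1)" using wilson_theorem[OF prime]
      unfolding y_def by (metis cong_minus_minus_iff minus_minus power_one_right of_nat_1 of_nat_fact)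
    from cong_power_prime[OF cong_power_prime[OF this]]
    have "[(y ^ p) ^ p = 1] (mod int p ^ 3)" by (simp add: eval_nat_numeral)
    hence "[((y ^ p) ^ p) ^ c = 1 ^ c] (mod int p ^ 3)" by (rule cong_pow)
    hence "[y * ((y ^ p) ^ p) ^ c = y * 1] (mod int p ^ 3)" by (intro cong_scalar_left) simp
    moreover have "y * ((y ^ p) ^ p) ^ c = y ^ (n * t)"
      unfolding c by (simp add: power_add power_mult power2_eq_square)
    ultimately show ?thesis by simp
  qed
  ultimately show ?thesis unfolding y_def by (metis cong_trans)
qed

end

text \<open>The factors of the Pochhammer symbol are \<open>(1 + j * n) / n\<close> with
  \<open>0 < 1 + j * n < p\<close>.\<close>

lemma p_integral_inverse_pochhammer:
  assumes prime: "Factorial_Ring.prime p" and n: "n > 0" and nm: "n * m = p - 1"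
  shows "p_integral p (1 / pochhammer (1 / of_nat n) m)"
proof -
  have "(1 / pochhammer (1 / of_nat n) m :: rat) = (\<Prod>j<m. 1 / (1 / of_nat n + of_nat j))"
    unfolding pochhammer_prod lessThan_atLeast0[symmetric] by (simp add: prod_dividef)
  also have "\<dots> = (\<Prod>j<m. of_nat n * (1 / of_nat (1 + j * n)))"
    using n by (intro prod.cong refl) (simp add: field_simps)
  finally have eq: "(1 / pochhammer (1 / of_nat n) m :: rat) = (\<Prod>j<m. of_nat n * (1 / of_nat (1 + j * n)))" .
  have "\<not> p dvd 1 + j * n" if "j < m" for j
  proof -
    have "(j + 1) * n \<le> m * n" using that by (intro mult_le_mono1) simp
    hence "1 + j * n < p" using nm prime_gt_1_nat[OF prime] n by (simp add: algebra_simps)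
    thus ?thesis by (auto dest: dvd_imp_le)
  qed
  thus ?thesis unfolding eq
    by (intro p_integral_prod[OF prime] p_integral_mult[OF prime] p_integral_of_nat[OF prime]
        p_integral_inverse_nat[OF prime]) auto
qed

section \<open>The hypergeometric sum as a finite difference modulo the cube of the prime\<close>

lemma hypergeometric_sum_cong:
  fixes n m p :: nat
  assumes prime: "Factorial_Ring.prime p" and n: "n \<ge> 3" and nm: "n * m = p - 1"
  shows "rat_cong p 3
    (\<Sum>k=0..p-1. (of_nat p * fact k / pochhammer (of_nat (n + 1) / of_nat n) k) ^ n)
    (fact (p - 1) * (1 / pochhammer (1 / of_nat n) m) ^ n)"
proof -
  note [trans] = rat_cong_trans[OF prime]
  note intros = p_integral_intros[OF prime] p_integral_numeral[OF prime]
  have p1: "p > 1" using prime_gt_1_nat[OF prime] .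
  have m: "m > 0" using p1 nm by (cases m) auto
  have "n * 1 \<le> n * m" using m by (intro mult_le_mono2) simp
  hence np: "n < p" "p \<ge> 3" using nm n p1 by linarith+
  have odd: "odd p" using prime np n by (simp add: prime_odd_nat)
  define a :: rat where "a = 1 / of_nat n"
  define b :: rat where "b = of_nat (n + 1) / of_nat n"
  define P :: rat where "P = of_nat p"
  define g where "g = 1 / pochhammer a m"
  define u where "u k = P * fact k / pochhammer b k" for k
  \<comment> \<open>The polynomial form serves as definition, since it shows integrality and the
    degree in \<open>k\<close>; the quotient form is recovered in \<open>vur\<close>.\<close>
  define v where "v k = g * pochhammer (b + of_nat k) m" for k
  define r where "r k = (\<Prod>l=1..k. 1 + P * (a / of_nat l))" for k
  define w where "w k = (- 1) ^ k * (of_nat (p - 1 choose k) :: rat)" for k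
  have a: "a > 0" "of_nat n * a = 1" and b: "b = a + 1" "b > 0" and P: "P > 0"
    using n p1 by (auto simp: a_def b_def P_def field_simps)
  have "p = 1 + n * m" using nm p1 by simp
  hence Pnm: "P = 1 + of_nat n * of_nat m" unfolding P_def by (metis of_nat_1 of_nat_add of_nat_mult)
  have am: "a + of_nat m = P * a" unfolding Pnm a_def using n by (simp add: field_simps)
  \<comment> \<open>Both sides are the product of the \<open>m + 1\<close> factors from
    \<open>a\<close> to \<open>a + m\<close>, split at either end; the last factor is
    \<open>P * a\<close>.\<close>
  have "a * pochhammer b m = a * (P * pochhammer a m)"
    using pochhammer_rec[of a m] pochhammer_Suc[of a m] am b(1) by (auto simp: mult_ac)
  hence bm: "pochhammer b m = P * pochhammer a m" using a(1) by simp
  have posa: "pochhammer a m > 0" using a by (intro pochhammer_pos)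
  have posb: "pochhammer b k > 0" for k using b by (intro pochhammer_pos)
  have aint: "p_integral p a" unfolding a_def
    using np n by (intro p_integral_inverse_nat[OF prime]) (auto dest: dvd_imp_le)
  have lint: "p_integral p (1 / of_nat l)" if "0 < l" "l < p" for l
    using that by (intro p_integral_inverse_nat[OF prime]) (auto dest: dvd_imp_le)
  have alint: "p_integral p (a / of_nat l)" if "0 < l" "l < p" for l
    using p_integral_mult[OF prime aint lint[OF that]] by simp
  have gint: "p_integral p g"
    unfolding g_def a_def using n nm by (intro p_integral_inverse_pochhammer[OF prime]) auto
  have vint: "p_integral p (v k)" for k
    unfolding v_def pochhammer_prod b(1) using gint aint by (auto intro!: intros)
  have rpos: "r k > 0" for k unfolding r_def using a P by (intro prod_pos) (auto intro!: add_pos_nonneg)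
  have vur: "v k = u k * r k" for k
  proof -
    \<comment> \<open>Both sides are \<open>pochhammer b (k + m)\<close>, split after
      \<open>k\<close> or after \<open>m\<close> factors.\<close>
    have "pochhammer b k * pochhammer (b + of_nat k) m = pochhammer b m * pochhammer (b + of_nat m) k"
      using pochhammer_product'[of b k m] pochhammer_product'[of b m k] by (simp add: add.commute)
    also have "b + of_nat m = 1 + P * a" unfolding b(1) using am by (simp add: algebra_simps)
    also have "pochhammer (1 + P * a) k = fact k * r k" unfolding pochhammer_one_plus r_def by simp
    finally have "pochhammer (b + of_nat k) m = P * pochhammer a m * (fact k * r k) / pochhammer b k"
      using posb[of k] bm by (simp add: field_simps)
    thus ?thesis unfolding v_def u_def g_def using posa by simp
  qed
  have rinv: "p_integral p (1 / r k)" if "k < p" for k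
  proof -
    have "1 / r k = (\<Prod>l=1..k. 1 / (1 + P * (a / of_nat l)))"
      unfolding r_def by (simp add: prod_dividef)
    also have "\<dots> = (\<Prod>l=1..k. of_nat (n * l) * (1 / of_nat (n * l + p)))"
      using n by (intro prod.cong refl) (auto simp: a_def P_def field_simps)
    finally have eq: "1 / r k = (\<Prod>l=1..k. of_nat (n * l) * (1 / of_nat (n * l + p)))" .
    have "\<not> p dvd n * l + p" if "l \<in> {1..k}" for l
    proof -
      have "\<not> p dvd n" "\<not> p dvd l" using that \<open>k < p\<close> np n by (auto dest: dvd_imp_le)
      thus ?thesis using prime by (simp add: prime_dvd_mult_iff)
    qed
    thus ?thesis unfolding eq
      by (intro p_integral_prod[OF prime] p_integral_mult[OF prime] p_integral_of_nat[OF prime]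
          p_integral_inverse_nat[OF prime])
  qed
  \<comment> \<open>For \<open>k \<ge> m\<close> the denominator of \<open>u k\<close> contains the
    factor \<open>p / n\<close>. Integrality is inherited from \<open>v k\<close>, because
    \<open>1 / r k\<close> is integral.\<close>
  have uint: "p_integral p (u k)" if "k < p" for k
  proof -
    have "u k = v k * (1 / r k)" using vur[of k] rpos[of k] by simp
    thus ?thesis using vint rinv[OF that] p_integral_mult[OF prime] by metis
  qed
  have uv: "rat_cong p 1 (u k) (v k)" if "k < p" for k
  proof -
    have "rat_cong p 1 (r k) (\<Prod>l=1..k. 1)" unfolding r_def P_def using that
      by (intro rat_cong_prod[OF prime] rat_cong_p_multiple[OF prime] alint) (auto intro: intros)
    from rat_cong_scale0[OF prime this uint[OF that]] show ?thesis
      unfolding vur using rat_cong_sym[OF prime] by simp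
  qed
  \<comment> \<open>By \<open>am\<close>, \<open>b + k + j = k - (m - 1 - j) + p * a\<close>, so
    modulo \<open>p\<close> the rising product turns into a falling factorial.\<close>
  have vg: "rat_cong p 1 (v k) (g * of_int (\<Prod>j<m. int k - int j))" for k
  proof -
    have "pochhammer (b + of_nat k) m = (\<Prod>j<m. (of_int (int k - int j) :: rat) + of_nat p * a)"
      unfolding pochhammer_prod lessThan_atLeast0[symmetric]
    proof (rule prod.reindex_bij_witness[of _ "\<lambda>j. m - 1 - j" "\<lambda>j. m - 1 - j"])
      fix j assume j: "j \<in> {..<m}"
      have "of_nat (m - 1 - j) = (of_nat m - 1 - of_nat j :: rat)" using j by (simp add: of_nat_diff)
      thus "of_int (int k - int (m - 1 - j)) + of_nat p * a = b + of_nat k + of_nat j"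
        using am unfolding b(1) P_def[symmetric] by simp
    qed auto
    moreover have "rat_cong p 1 (\<Prod>j<m. (of_int (int k - int j) :: rat) + of_nat p * a)
        (\<Prod>j<m. of_int (int k - int j))"
      by (intro rat_cong_prod[OF prime] rat_cong_p_multiple[OF prime] aint p_integral_of_int[OF prime])
    ultimately show ?thesis unfolding v_def
      using rat_cong_scale0[OF prime _ gint] by (simp del: of_int_diff)
  qed

  \<comment> \<open>Vanishing of the correction sum modulo the prime\<close>
  define H where "H k = (\<Sum>l=1..k. (1 / of_nat l :: rat)\<^sup>2)" for k
  define h where "h k = (\<Sum>l=1..k. int l ^ (p - 3))" for k
  define f where "f k = (\<Prod>j<m. int k - int j)" for k
  have Hh: "rat_cong p 1 (H k) (of_int (h k))" if "k < p" for k
    unfolding H_def h_def of_int_sum using that np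
    by (intro rat_cong_sum[OF prime] rat_cong_inverse_square[OF prime]) auto
  have Hint: "p_integral p (H k)" if "k < p" for k
    unfolding H_def using that
    by (intro p_integral_sum[OF prime] p_integral_power[OF prime] lint) auto
  have "rat_cong p 1 (\<Sum>k<p. u k ^ n * H k) (\<Sum>k<p. (g * of_int (f k)) ^ n * of_int (h k))"
  proof (intro rat_cong_sum[OF prime] rat_cong_mult[OF prime] rat_cong_power[OF prime])
    fix k assume "k \<in> {..<p}"
    hence k: "k < p" by simp
    show "rat_cong p 1 (u k) (g * of_int (f k))"
      using rat_cong_trans[OF prime uv[OF k] vg] unfolding f_def .
    show "rat_cong p 1 (H k) (of_int (h k))" using Hh[OF k] .
    show "p_integral p (g * of_int (f k))" "p_integral p (u k ^ n)" "p_integral p (of_int (h k))"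
      using gint uint[OF k] by (auto intro: intros)
  qed
  also have "(\<Sum>k<p. (g * of_int (f k)) ^ n * of_int (h k)) = g ^ n * of_int (\<Sum>k<p. f k ^ n * h k)"
    by (simp add: sum_distrib_left power_mult_distrib mult.assoc)
  also have "rat_cong p 1 \<dots> (g ^ n * of_int 0)"
    using sum_falling_harmonic_cong_0[OF prime n nm] gint unfolding f_def h_def
    by (intro rat_cong_scale0[OF prime] rat_cong_of_int[OF prime] p_integral_power[OF prime]) auto
  finally have uH: "rat_cong p 1 (\<Sum>k<p. u k ^ n * H k) 0" by simp

  \<comment> \<open>The coefficient of \<open>(p / l) ^ 2\<close> in
    \<open>(1 - p / l) * (1 + p * a / l) ^ n\<close>; the \<open>-1\<close> comes from the product
    of the two linear terms.\<close>
  define c where "c = of_nat (n choose 2) * a\<^sup>2 - 1"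
  have cint: "p_integral p c" unfolding c_def using aint by (auto intro!: intros)
  \<comment> \<open>The signed binomial coefficient \<open>w k\<close> is
    \<open>pochhammer (1 - P) k / k!\<close>, which supplies the factors
    \<open>1 - P / l\<close>.\<close>
  have wvn: "w k * v k ^ n = u k ^ n * (\<Prod>l=1..k. (1 + - P / of_nat l) * (1 + P * (a / of_nat l)) ^ n)" for k
  proof -
    have "(of_nat (p - 1) :: rat) = P - 1" using p1 by (simp add: P_def of_nat_diff)
    hence "w k = pochhammer (1 + - P) k / fact k"
      unfolding w_def binomial_gbinomial gbinomial_pochhammer by simp
    also have "\<dots> = (\<Prod>l=1..k. 1 + - P / of_nat l)" unfolding pochhammer_one_plus by simp
    finally show ?thesis unfolding vur prod.distrib prod_power_distrib[symmetric] r_def[symmetric]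
      by (simp add: power_mult_distrib)
  qed
  have fac: "rat_cong p 3 ((1 + - P / of_nat l) * (1 + P * (a / of_nat l)) ^ n)
      (1 + of_nat p ^ 2 * (c * (1 / of_nat l)\<^sup>2))" if l: "0 < l" "l < p" for l
  proof -
    define z :: rat where "z = 1 / of_nat l"
    have z: "p_integral p z" unfolding z_def by (rule lint[OF l])
    have eqs: "- P / of_nat l = - P * z" "a / of_nat l = a * z" by (simp_all add: z_def)
    let ?e = "1 + of_nat n * of_nat p * (a * z) + of_nat (n choose 2) * of_nat p ^ 2 * (a * z) ^ 2"
    have "rat_cong p 3 ((1 + - P * z) * (1 + P * (a * z)) ^ n) ((1 + - P * z) * ?e)"
      unfolding P_def using z aint
      by (intro rat_cong_scale0[OF prime] rat_cong_binomial[OF prime])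
        (auto intro!: intros)
    \<comment> \<open>Here \<open>n * a = 1\<close> makes the linear term \<open>P * z\<close>,
      which cancels against \<open>- P * z\<close>.\<close>
    also have "of_nat n * of_nat p * (a * z) = P * z"
      using a(2) unfolding P_def by (metis mult.assoc mult.commute mult_1)
    also have "rat_cong p 3 ((1 + - P * z) * (1 + P * z + of_nat (n choose 2) * of_nat p ^ 2 * (a * z) ^ 2))
        (1 + of_nat p ^ 2 * (c * z\<^sup>2))"
      using z aint
      by (intro rat_congI[OF prime, of "- of_nat (n choose 2) * a\<^sup>2 * z ^ 3"])
        (auto intro!: intros simp: c_def P_def algebra_simps power2_eq_square power3_eq_cube)
    finally show ?thesis unfolding eqs z_def[symmetric] .
  qed
  have "rat_cong p 3 (w k * v k ^ n) (u k ^ n + of_nat p ^ 2 * c * (u k ^ n * H k))" if k: "k < p" for k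
  proof -
    have ci: "p_integral p (c * (1 / of_nat l)\<^sup>2)" if "l \<in> {1..k}" for l
      using that k cint by (intro p_integral_mult[OF prime] p_integral_power[OF prime] lint) auto
    have gi: "p_integral p (1 + of_nat p ^ 2 * (c * (1 / of_nat l)\<^sup>2))" if "l \<in> {1..k}" for l
      by (intro p_integral_add[OF prime] p_integral_mult[OF prime _ ci[OF that]]
          p_integral_power[OF prime] p_integral_of_nat[OF prime] p_integral_numeral[OF prime])
    have "rat_cong p 3 (\<Prod>l=1..k. (1 + - P / of_nat l) * (1 + P * (a / of_nat l)) ^ n)
      (\<Prod>l=1..k. 1 + of_nat p ^ 2 * (c * (1 / of_nat l)\<^sup>2))"
      using k by (intro rat_cong_prod[OF prime] fac gi) auto
    also have "rat_cong p 3 \<dots> (1 + of_nat p ^ 2 * (\<Sum>l=1..k. c * (1 / of_nat l)\<^sup>2))"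
      by (rule rat_cong_prod_one_plus[OF prime ci])
    also have "(\<Sum>l=1..k. c * (1 / of_nat l)\<^sup>2) = c * H k" unfolding H_def sum_distrib_left ..
    finally
    have "rat_cong p 3 (u k ^ n * (\<Prod>l=1..k. (1 + - P / of_nat l) * (1 + P * (a / of_nat l)) ^ n))
      (u k ^ n * (1 + of_nat p ^ 2 * (c * H k)))"
      using uint[OF k] by (intro rat_cong_scale0[OF prime] p_integral_power[OF prime])
    thus ?thesis unfolding wvn by (simp add: algebra_simps)
  qed
  hence "rat_cong p 3 (\<Sum>k<p. w k * v k ^ n) (\<Sum>k<p. u k ^ n + of_nat p ^ 2 * c * (u k ^ n * H k))"
    by (intro rat_cong_sum[OF prime]) auto
  also have "(\<Sum>k<p. u k ^ n + of_nat p ^ 2 * c * (u k ^ n * H k)) =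
      (\<Sum>k<p. u k ^ n) + of_nat p ^ 2 * c * (\<Sum>k<p. u k ^ n * H k)"
    by (simp add: sum.distrib sum_distrib_left)
  also have "rat_cong p 3 \<dots> ((\<Sum>k<p. u k ^ n) + of_nat p ^ 2 * c * 0)"
    using rat_cong_scale[OF prime uH cint, of 2]
    by (intro rat_cong_add[OF prime] rat_cong_refl[OF prime]) (simp add: eval_nat_numeral)
  finally have wu: "rat_cong p 3 (\<Sum>k<p. w k * v k ^ n) (\<Sum>k<p. u k ^ n)"
    by simp

  \<comment> \<open>Exact evaluation of the finite difference\<close>
  have range: "{..<p} = {..p - 1}" "{..<p} = {0..p - 1}" using p1 by auto
  \<comment> \<open>\<open>A\<close> indexes the \<open>m * n = p - 1\<close> monic linear factors
    in \<open>k\<close> of the \<open>n\<close>-th power, so the degree equals the order of the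
    difference and only \<open>(p - 1)!\<close> remains.\<close>
  define A where "A = {..<m} \<times> {..<n}"
  have poch: "pochhammer (b + of_nat k) m ^ n = (\<Prod>i\<in>A. of_nat k + (b + of_nat (fst i)))" for k
  proof -
    have "(\<Prod>i\<in>A. of_nat k + (b + of_nat (fst i))) = (\<Prod>i<m. \<Prod>j<n. of_nat k + (b + of_nat i))"
      unfolding A_def prod.cartesian_product by (simp add: split_beta)
    thus ?thesis
      by (simp add: pochhammer_prod lessThan_atLeast0 prod_power_distrib add_ac)
  qed
  have cardA: "card A = p - 1" unfolding A_def using nm by (simp add: mult.commute)
  have "(\<Sum>k<p. w k * v k ^ n) =
      g ^ n * (\<Sum>k\<le>p - 1. (- 1) ^ k * of_nat (p - 1 choose k) * (\<Prod>i\<in>A. of_nat k + (b + of_nat (fst i))))"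
    unfolding range(1) w_def v_def power_mult_distrib poch by (simp add: sum_distrib_left mult_ac)
  also have "(\<Sum>k\<le>p - 1. (- 1) ^ k * of_nat (p - 1 choose k) * (\<Prod>i\<in>A. of_nat k + (b + of_nat (fst i)))) =
      fact (p - 1)"
    using alternating_binomial_prod[of A "p - 1" "\<lambda>i. b + of_nat (fst i)"] cardA odd p1
    by (simp add: A_def)
  finally have "(\<Sum>k<p. w k * v k ^ n) = fact (p - 1) * g ^ n" by (simp add: mult.commute)
  thus ?thesis using rat_cong_sym[OF prime wu]
    unfolding range(2) u_def g_def a_def b_def P_def by simp
qed

text \<open>\<open>N\<close> represents \<open>1 / n\<close> modulo \<open>p ^ 3\<close>. So does
  \<open>M = p * t - m\<close>, because \<open>n * M = p * (n * t) - (p - 1)\<close>. From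
  \<open>M\<close> the functional equation leads in \<open>m\<close> steps to \<open>p * t\<close>,
  where the value is known, and the factors collected form \<open>pochhammer (1 / n) m\<close>
  modulo \<open>p ^ 3\<close>.\<close>

lemma Gamma_p_nat_power_rat_cong:
  fixes n m p N :: nat
  assumes prime: "Factorial_Ring.prime p" and p5: "p \<ge> 5" and n: "n > 0" and nm: "n * m = p - 1"
    and N: "[n * N = 1] (mod p ^ 3)"
  shows "rat_cong p 3 (fact (p - 1) * (1 / pochhammer (1 / of_nat n) m) ^ n)
    (of_int (- (Gamma_p_nat p N ^ n)))"
proof -
  note [trans] = rat_cong_trans[OF prime]
  have odd: "odd p" using prime p5 by (simp add: prime_odd_nat)
  have p1: "p = n * m + 1" using nm p5 by simp
  have "m \<le> n * m" using n by simp
  hence mp: "m < p" using p1 by linarith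
  have "n dvd p - 1" unfolding nm[symmetric] by simp
  hence "n \<le> p - 1" using p5 by (intro dvd_imp_le) auto
  hence pn: "\<not> p dvd n" using n p5 by (auto dest: dvd_imp_le)
  hence cop: "coprime n (p ^ k)" for k
    using prime prime_imp_coprime[of p n] by (simp add: coprime_commute)
  \<comment> \<open>Precision \<open>p ^ 2\<close> suffices for \<open>t\<close>, since it enters
    only through \<open>p * t\<close>.\<close>
  obtain t where t: "[n * t = 1] (mod p ^ 2)" using cong_solve_coprime_nat[OF cop] by auto
  \<comment> \<open>Positivity keeps the natural subtraction \<open>p * t - m\<close> from being
    truncated.\<close>
  have "t > 0"
  proof (rule ccontr)
    assume "\<not> t > 0"
    hence "[1 = 0] (mod p ^ 2)" using t by (simp add: cong_sym_eq)
    hence "p ^ 2 dvd 1" by (simp only: cong_0_iff)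
    thus False using p5 by simp
  qed
  define M where "M = p * t - m"
  have "p \<le> p * t" using \<open>t > 0\<close> by simp
  hence M: "M + m = p * t" using mp unfolding M_def by linarith
  have nM: "[n * M = 1] (mod p ^ 3)"
  proof -
    have "int n * int M = int p * (int n * int t) - int n * int m"
      using M by (metis add_diff_cancel_right' mult.left_commute of_nat_add of_nat_mult right_diff_distrib)
    hence "int n * int M - 1 = int p * (int n * int t - 1)" using p1 by (simp add: algebra_simps)
    moreover have "int p ^ 2 dvd int n * int t - 1"
      using t by (metis cong_iff_dvd_diff cong_int_iff of_nat_1 of_nat_mult of_nat_power)
    ultimately have "int p * int p ^ 2 dvd int n * int M - 1" by (simp add: mult_dvd_mono)
    hence "[int (n * M) = int 1] (mod int (p ^ 3))" by (simp add: cong_iff_dvd_diff eval_nat_numeral)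
    thus ?thesis by (simp only: cong_int_iff)
  qed
  hence "[n * M = n * N] (mod p ^ 3)" using N cong_trans cong_sym by blast
  hence "[M = N] (mod p ^ 3)" using cong_mult_lcancel_nat[OF cop] by blast
  hence GMN: "[Gamma_p_nat p M = Gamma_p_nat p N] (mod int p ^ 3)"
    by (rule Gamma_p_nat_cong[OF prime odd])
  define Q where "Q = (\<Prod>i<m. int (M + i))"
  have "Gamma_p_nat p (p * t) = Gamma_p_nat p M * (- 1) ^ m * Q"
    unfolding M[symmetric] Q_def
  proof (rule Gamma_p_nat_add)
    fix i assume i: "i < m"
    show "\<not> p dvd M + i"
    proof
      assume "p dvd M + i"
      moreover have "p * t = (M + i) + (m - i)" using M i by simp
      ultimately have "p dvd m - i" by (metis dvd_add_right_iff dvd_triv_left)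
      thus False using i mp by (auto dest: dvd_imp_le)
    qed
  qed
  moreover have "((- 1) ^ m) ^ n = (1::int)"
    using odd p1 by (simp add: power_mult[symmetric] mult.commute)
  ultimately have "Gamma_p_nat p (p * t) ^ n = Gamma_p_nat p M ^ n * Q ^ n"
    by (simp add: power_mult_distrib)
  moreover have "[Gamma_p_nat p (p * t) ^ n = - fact (p - 1)] (mod int p ^ 3)"
    by (rule Gamma_p_nat_power_cong[OF prime p5 t])
  moreover have "[Gamma_p_nat p M ^ n * Q ^ n = Gamma_p_nat p N ^ n * Q ^ n] (mod int p ^ 3)"
    by (intro cong_mult cong_pow GMN cong_refl)
  ultimately have "[Gamma_p_nat p N ^ n * Q ^ n = - fact (p - 1)] (mod int p ^ 3)"
    by (metis cong_sym cong_trans)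
  hence "[- fact (p - 1) = Gamma_p_nat p N ^ n * Q ^ n] (mod int p ^ 3)" by (rule cong_sym)
  hence "[fact (p - 1) = - (Gamma_p_nat p N ^ n) * Q ^ n] (mod int p ^ 3)"
    by (metis cong_minus_minus_iff minus_minus mult_minus_left)
  from rat_cong_of_int[OF prime this]
  have 1: "rat_cong p 3 (fact (p - 1)) (of_int (- (Gamma_p_nat p N ^ n)) * of_int Q ^ n)" by simp

  define a :: rat where "a = 1 / of_nat n"
  define g where "g = 1 / pochhammer a m"
  have gint: "p_integral p g"
    unfolding g_def a_def by (rule p_integral_inverse_pochhammer[OF prime n nm])
  have aint: "p_integral p a" unfolding a_def by (rule p_integral_inverse_nat[OF prime pn])
  have "[int (n * M) = int 1] (mod int (p ^ 3))" using nM by (simp only: cong_int_iff)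
  hence "[int n * int M = 1] (mod int p ^ 3)" by simp
  from rat_cong_scale0[OF prime rat_cong_of_int[OF prime this] aint]
  have Ma: "rat_cong p 3 (of_nat M) a" using n by (simp add: a_def)
  have "rat_cong p 3 (\<Prod>i<m. of_nat M + of_nat i) (\<Prod>i<m. a + of_nat i)"
    using aint by (intro rat_cong_prod[OF prime] rat_cong_add[OF prime] Ma rat_cong_refl[OF prime]
        p_integral_add[OF prime] p_integral_of_nat[OF prime])
  hence QE: "rat_cong p 3 (of_int Q) (pochhammer a m)"
    by (simp add: Q_def pochhammer_prod lessThan_atLeast0)
  have "pochhammer a m > 0" using n by (intro pochhammer_pos) (simp add: a_def)
  hence "rat_cong p 3 (g * of_int Q) 1" using rat_cong_scale0[OF prime QE gint] by (simp add: g_def)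
  from rat_cong_power[OF prime this, of n] p_integral_numeral[OF prime]
  have gQ: "rat_cong p 3 ((g * of_int Q) ^ n) 1" by simp
  have "rat_cong p 3 (g ^ n * fact (p - 1)) (g ^ n * (of_int (- (Gamma_p_nat p N ^ n)) * of_int Q ^ n))"
    using rat_cong_scale0[OF prime 1] gint p_integral_power[OF prime] by blast
  also have "g ^ n * (of_int (- (Gamma_p_nat p N ^ n)) * of_int Q ^ n) =
      of_int (- (Gamma_p_nat p N ^ n)) * (g * of_int Q) ^ n" by (simp add: power_mult_distrib)
  also have "rat_cong p 3 \<dots> (of_int (- (Gamma_p_nat p N ^ n)) * 1)"
    using gQ by (intro rat_cong_scale0[OF prime] p_integral_of_int[OF prime])
  finally show ?thesis
    by (simp add: g_def a_def mult.commute)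
qed

theorem theorem1p2:
  fixes n p :: nat
  assumes "n \<ge> 3" and "Factorial_Ring.prime p" and "[p = 1] (mod n)"
  shows "let S = (\<Sum>k=0..p-1.
                   (of_nat p * fact k / pochhammer (of_nat (n + 1) / of_nat n) k) ^ n) :: rat
         in of_nat p ^ n *
              trunc_hypergeometric (replicate (n + 1) 1)
                (replicate n (of_nat (n + 1) / of_nat n)) 1 (p - 1) = S \<and>
            p_integral p S \<and>
            padic_cong p 3 (padic_of_rat p S)
              (\<ominus>\<^bsub>padic_ring p\<^esub>
                (Gamma_p p (padic_of_rat p (1 / of_nat n)) [^]\<^bsub>padic_ring p\<^esub> n))"
proof -
  note prime = assms(2)
  define S :: rat where
    "S = (\<Sum>k=0..p-1. (of_nat p * fact k / pochhammer (of_nat (n + 1) / of_nat n) k) ^ n)"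
  have p1: "p > 1" using prime_gt_1_nat[OF prime] .
  have "n dvd p - 1" using assms(3) p1 by (metis cong_altdef_nat cong_sym less_imp_le cong_to_1_nat)
  then obtain m where nm: "n * m = p - 1" by (metis dvd_def)
  have "n \<le> p - 1" using \<open>n dvd p - 1\<close> p1 by (intro dvd_imp_le) auto
  hence p4: "p \<ge> 4" "n < p" using assms(1) by linarith+
  have "p \<noteq> 4" using prime prime_odd_nat[of p] by auto
  with p4 have p5: "p \<ge> 5" by simp
  have odd: "odd p" using prime p5 by (simp add: prime_odd_nat)
  have "p > 0" using p1 by simp
  interpret cring "padic_ring p" by (rule padic_ring_cring[OF \<open>p > 0\<close>])

  \<comment> \<open>The \<open>n + 1\<close> symbols \<open>pochhammer 1 k\<close> are each
    \<open>k!\<close>; one cancels against the factorial of the series.\<close>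
  have trunc: "of_nat p ^ n * trunc_hypergeometric (replicate (n + 1) 1)
      (replicate n (of_nat (n + 1) / of_nat n)) 1 (p - 1) = S"
    unfolding trunc_hypergeometric_def S_def sum_distrib_left
    by (intro sum.cong refl)
      (simp add: map_replicate_const prod_list_replicate pochhammer_fact[symmetric]
        power_mult_distrib power_divide)

  define x where "x = padic_of_rat p (1 / of_nat n)"
  \<comment> \<open>The residue at index \<open>3\<close> is a natural number representing
    \<open>1 / n\<close> modulo \<open>p ^ 3\<close>.\<close>
  define N where "N = nat (x 3)"
  have pn: "\<not> p dvd n" using assms(1) p4 by (auto dest: dvd_imp_le)
  have qn: "quotient_of (1 / of_nat n) = (1, int n)"
    using assms(1) by (simp add: Fract_of_int_quotient[of 1 "int n", simplified, symmetric]
        quotient_of_Fract Rat.normalize_def)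
  have nint: "p_integral p (1 / of_nat n)" by (rule p_integral_inverse_nat[OF prime pn])
  have x: "x \<in> carrier (padic_ring p)" unfolding x_def by (rule padic_of_rat[OF prime nint])
  have "int N = x 3" unfolding N_def using padic_nonneg[OF prime x] by simp
  hence "[int (n * N) = int 1] (mod int (p ^ 3))"
    using padic_of_rat(2)[OF prime nint, of 3] by (simp add: qn x_def)
  hence N: "[n * N = 1] (mod p ^ 3)" by (simp only: cong_int_iff)
  define y where "y = Gamma_p p x [^]\<^bsub>padic_ring p\<^esub> n"
  have y: "y \<in> carrier (padic_ring p)"
    unfolding y_def by (intro nat_pow_closed Gamma_p_eq(2)[OF prime odd x])
  have "y 3 = (Gamma_p_nat p N mod int p ^ 3) ^ n mod int p ^ 3"
    unfolding y_def padic_pow_eval[OF prime] Gamma_p_eq(1)[OF prime odd x] N_def ..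
  hence y3: "[y 3 = Gamma_p_nat p N ^ n] (mod int p ^ 3)" by (simp add: cong_def power_mod)

  have SG: "rat_cong p 3 S (of_int (- (Gamma_p_nat p N ^ n)))"
    unfolding S_def
  proof (rule rat_cong_trans[OF prime hypergeometric_sum_cong[OF prime assms(1) nm]])
    show "rat_cong p 3 (fact (p - 1) * (1 / pochhammer (1 / of_nat n) m) ^ n)
        (of_int (- (Gamma_p_nat p N ^ n)))"
      using assms(1) by (intro Gamma_p_nat_power_rat_cong[OF prime p5 _ nm N]) simp
  qed
  have Sint: "p_integral p S" by (rule rat_cong_integral[OF prime SG p_integral_of_int[OF prime]])
  \<comment> \<open>The residue of \<open>S\<close> is known only through its reduced fraction, so
    the congruence is multiplied by the denominator \<open>d\<close>, compared over the integers,
    and \<open>d\<close> is cancelled as a unit.\<close>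
  define c d where "c = fst (quotient_of S)" and "d = snd (quotient_of S)"
  have nd: "\<not> int p dvd d" using Sint by (simp add: p_integral_def d_def)
  have "S = of_int c / of_int d" unfolding c_def d_def by (rule quotient_of_div) simp
  moreover have "d \<noteq> 0" using nd by auto
  ultimately have "of_int d * S = of_int c" by simp
  hence "rat_cong p 3 (of_int c) (of_int (d * - (Gamma_p_nat p N ^ n)))"
    using rat_cong_scale0[OF prime SG p_integral_of_int[OF prime], of d] by simp
  hence "[c = d * - (Gamma_p_nat p N ^ n)] (mod int p ^ 3)" unfolding rat_cong_of_int_iff[OF prime] .
  with padic_of_rat(2)[OF prime Sint, of 3]
  have "[d * padic_of_rat p S 3 = d * - (Gamma_p_nat p N ^ n)] (mod int p ^ 3)"
    unfolding c_def d_def by (rule cong_trans)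
  moreover have "coprime d (int p ^ 3)"
    using nd prime prime_imp_coprime[of "int p" d] by (simp add: coprime_commute)
  ultimately have "[padic_of_rat p S 3 = - (Gamma_p_nat p N ^ n)] (mod int p ^ 3)"
    using cong_mult_lcancel by blast
  from cong_add[OF this y3] have "[padic_of_rat p S 3 + y 3 = 0] (mod int p ^ 3)" by simp
  hence "padic_cong p 3 (padic_of_rat p S) (\<ominus>\<^bsub>padic_ring p\<^esub> y)"
    by (intro padic_cong_uminusI[OF prime] padic_of_rat(1)[OF prime Sint] y)
  thus ?thesis using trunc Sint unfolding S_def[symmetric] Let_def y_def x_def by blast
qed

end
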